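(* Let $\gamma\le0$. Then there is no smoothing in the nonlinear part $P_t(f)$ of the first Picard iterate for the equation $u_t+u_{xxx}-\gamma\partial_x^{-1}u+\partial_x(u^2)=0$ on $\mathbb R$. Precisely: for every $s\in\mathbb R$ and every $t>0$ there is a family of real-valued functions $f_N$ (indexed by sufficiently large $N$) with $\|f_N\|_{H^s(\mathbb R)}\approx1$ uniformly in $N$, such that for every $a>0$ $$\sup_N\|P_t(f_N)\|_{H^{s+a}(\mathbb R)}=\infty .$$
   Context: Fourier convention: $\widehat f(\xi)=\frac1{2\pi}\int_{\mathbb R}e^{-ix\xi}f(x)\,dx$, so that $\partial_x$ corresponds to multiplication by $i\xi$ and $\widehat{fg}=\widehat f*\widehat g$. The Sobolev norm is $\|f\|_{H^s}=\left(\int_{\mathbb R}(1+\xi^2)^{s}|\widehat f(\xi)|^2d\xi\right)^{1/2}$. The operator $\partial_x^{-1}$ is defined by $\widehat{\partial_x^{-1}f}(\xi)=\frac{\widehat f(\xi)}{i\xi}$. Let $Lu=u_{xxx}-\gamma\partial_x^{-1}u$, $N(u)=\partial_x(u^2)$ and $\phi(\xi)=\xi^3-\frac{\gamma}{\xi}$; then $\widehat{e^{Lt}f}(\xi)=e^{-i\phi(\xi)t}\widehat f(\xi)$. The Duhamel formulation of the Cauchy problem with data $f$ is $u=e^{-Lt}f-e^{-Lt}\int_0^te^{Ls'}N(u)\,ds'$. The nonlinear part of the first Picard iterate is obtained by replacing $u$ in the integral by $e^{-Ls'}f$: $$P_t(f)=-e^{-Lt}\int_0^te^{Ls'}N(e^{-Ls'}f)\,ds'.$$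 On the Fourier side, up to a unimodular constant factor, $\widehat{P_t(f)}(\xi)$ equals $$e^{i\phi(\xi)t}\,\xi\int_{\mathbb R}\frac{e^{-i[\phi(\xi)-\phi(\eta)-\phi(\xi-\eta)]t}-1}{\phi(\xi)-\phi(\eta)-\phi(\xi-\eta)}\,\widehat f(\eta)\widehat f(\xi-\eta)\,d\eta .$$ The notation $A_N\approx1$ means that $A_N$ is bounded above and below by positive constants independent of $N$. *)

theory Defs
  imports "HOL-Analysis.Analysis"
begin

definition fourier_integral :: "(real \<Rightarrow> complex) \<Rightarrow> real \<Rightarrow> complex" where
  "fourier_integral f \<xi> = complex_of_real (1 / (2 * pi)) * (LBINT x. cis (- (x * \<xi>)) * f x)"

definition square_integrable :: "(real \<Rightarrow> complex) \<Rightarrow> bool" where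
  "square_integrable f \<longleftrightarrow>
     f \<in> borel_measurable lborel \<and> integrable lborel (\<lambda>x. (norm (f x))\<^sup>2)"

(* F is the Plancherel transform of f: the L^2 limit of the transforms of the truncations of f. *)
definition is_plancherel_transform :: "(real \<Rightarrow> complex) \<Rightarrow> (real \<Rightarrow> complex) \<Rightarrow> bool" where
  "is_plancherel_transform f F \<longleftrightarrow> square_integrable F \<and>
     ((\<lambda>R. \<integral>\<^sup>+ \<xi>. ennreal ((norm (F \<xi> -
          fourier_integral (\<lambda>x. indicator {-R..R} x * f x) \<xi>))\<^sup>2) \<partial>lborel) \<longlongrightarrow> 0) at_top"

(* The transform on L^1 and on L^2. On L^2 it is determined up to null sets, and a representative
   is chosen; outside L^1 and L^2 the value 0 is a convention. *)
definition fourier :: "(real \<Rightarrow> complex) \<Rightarrow> real \<Rightarrow> complex" where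
  "fourier f =
     (if integrable lborel f then fourier_integral f
      else if square_integrable f then (SOME F. is_plancherel_transform f F)
      else (\<lambda>_. 0))"

(* On L^1 this is the integral of exp(i x xi) F(xi) over xi. *)
definition inv_fourier :: "(real \<Rightarrow> complex) \<Rightarrow> real \<Rightarrow> complex" where
  "inv_fourier F x = complex_of_real (2 * pi) * fourier F (- x)"

(* The H^s norm, with value infinity when the defining integral diverges. *)
definition sobolev_norm :: "real \<Rightarrow> (real \<Rightarrow> complex) \<Rightarrow> ennreal" where
  "sobolev_norm s f =
     (let I = \<integral>\<^sup>+ \<xi>. ennreal ((1 + \<xi>\<^sup>2) powr s * (norm (fourier f \<xi>))\<^sup>2) \<partial>lborel
      in if I = \<infinity> then \<infinity> else ennreal (sqrt (enn2real I)))"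

definition phi :: "real \<Rightarrow> real \<Rightarrow> real" where
  "phi \<gamma> \<xi> = \<xi> ^ 3 - \<gamma> / \<xi>"

(* exp(t L) for L u = u_xxx - gamma (d/dx)^{-1} u. The Fourier symbol of L is
   (i xi)^3 - gamma / (i xi) = - i phi(xi). *)
definition exp_L :: "real \<Rightarrow> real \<Rightarrow> (real \<Rightarrow> complex) \<Rightarrow> real \<Rightarrow> complex" where
  "exp_L \<gamma> t f = inv_fourier (\<lambda>\<xi>. cis (- (phi \<gamma> \<xi> * t)) * fourier f \<xi>)"

definition nonlin :: "(real \<Rightarrow> complex) \<Rightarrow> real \<Rightarrow> complex" where
  "nonlin u x = vector_derivative (\<lambda>y. (u y)\<^sup>2) (at x)"

definition picard_nonlinear :: "real \<Rightarrow> real \<Rightarrow> (real \<Rightarrow> complex) \<Rightarrow> real \<Rightarrow> complex" where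
  "picard_nonlinear \<gamma> t f x =
     - exp_L \<gamma> (- t) (\<lambda>y. LBINT \<tau>:{0..t}. exp_L \<gamma> \<tau> (nonlin (exp_L \<gamma> (- \<tau>) f)) y) x"

end

theory Submission
  imports Defs "HOL-Probability.Characteristic_Functions"
begin

text \<open>The quadratic nonlinearity makes frequencies \<open>\<eta>\<close> and \<open>\<zeta>\<close> interact to produce
\<open>\<xi> = \<eta> + \<zeta>\<close>, and the contribution to the Picard iterate is an integral over \<open>\<tau>\<close> in \<open>{0..t}\<close> of a
phase with frequency \<open>\<Omega> = phi \<gamma> \<xi> - phi \<gamma> \<eta> - phi \<gamma> \<zeta>\<close>. Smoothing could only come from \<open>\<Omega>\<close> being
large. Since \<open>\<Omega> = 3 * \<xi> * \<eta> * \<zeta> - \<gamma> * (1 / \<xi> - 1 / \<eta> - 1 / \<zeta>)\<close>, for \<open>\<gamma> \<le> 0\<close> the interaction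
of a high frequency \<open>N\<close> with the low frequency \<open>sqrt (- \<gamma> / 3) / N\<close> is resonant to leading order, and
\<open>\<Omega>\<close> remains bounded by \<open>1 / t\<close> if both frequencies vary over intervals of length \<open>\<delta> = c / N\<^sup>2\<close>
with \<open>c\<close> small and \<open>N\<close> large (\<open>resonance_bound\<close>).

The data \<open>f N\<close> have as Fourier transform the suitably weighted indicator of two such intervals and
of their mirror images (\<open>profile\<close>). Their norm of order \<open>s\<close> is of order one
(\<open>sobolev_norm_profile\<close>). At output frequencies that only the resonant pair can reach
(\<open>profile_interaction_support\<close>) the phases do not cancel (\<open>norm_duhamel_ge\<close>), and counting powers of
\<open>N\<close> gives a norm of order \<open>s + a\<close> at least a constant times \<open>N powr a\<close>
(\<open>sobolev_norm_picard_profile_ge\<close>).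

It has to be justified that the iterate, built in physical space from repeated transforms, has the
expected Fourier symbol. Every function that occurs is \<open>synth m\<close> for a bounded, compactly
supported symbol \<open>m\<close> that is continuous almost everywhere (\<open>tame\<close>). For such symbols
\<open>fourier (synth m)\<close> agrees with \<open>m\<close> almost everywhere (\<open>fourier_synth\<close>), by inversion if \<open>synth m\<close>
is integrable and by Plancherel otherwise; both are proved by Gaussian summation
(\<open>gauss_mean_synth\<close>). Squaring, differentiation, the linear flow and the integral over time then
become operations on symbols (\<open>picard_nonlinear_synth\<close>).\<close>

section \<open>Measurability and integration preliminaries\<close>

lemma continuous_on_cis' [continuous_intros]:
  "continuous_on A f \<Longrightarrow> continuous_on A (\<lambda>x. cis (f x))"
  by (simp add: cis_conv_exp) (intro continuous_intros)

lemma isCont_cis' [continuous_intros]: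
  "isCont f a \<Longrightarrow> isCont (\<lambda>x. cis (f x)) a"
  unfolding cis_conv_exp by (intro continuous_intros)

lemma borel_measurable_cis [measurable (raw)]:
  assumes [measurable]: "f \<in> borel_measurable M"
  shows "(\<lambda>x. cis (f x)) \<in> borel_measurable M"
proof -
  have [measurable]: "cis \<in> borel_measurable borel"
    by (intro borel_measurable_continuous_onI continuous_intros)
  show ?thesis by measurable
qed

lemma AE_lborel_affine:
  fixes c t :: real
  assumes "c \<noteq> 0" and "AE x in lborel. P x"
  shows "AE x in lborel. P (t + c * x)"
proof -
  obtain S where S: "S \<in> sets lborel" "emeasure lborel S = 0" "{x. \<not> P x} \<subseteq> S"
    using assms(2) unfolding eventually_ae_filter by (auto simp: null_sets_def)
  have "(\<integral>\<^sup>+x. indicator S (t + c * x) \<partial>lborel) = 0"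
    using nn_integral_real_affine[of "indicator S" c t] S assms(1)
    by (auto simp: ennreal_mult_eq_top_iff)
  then have "AE x in lborel. indicator S (t + c * x) = (0::ennreal)"
    using S by (subst (asm) nn_integral_0_iff_AE) auto
  then show ?thesis
    by eventually_elim (use S(3) in \<open>auto simp: indicator_def split: if_splits\<close>)
qed

text \<open>All interchanges of integrals below have a kernel that is dominated by a product of two
integrable functions of one variable each, so this one criterion replaces separate appeals to
Fubini.\<close>
lemma integrable_lborel_product:
  fixes f :: "real \<Rightarrow> real \<Rightarrow> complex"
  assumes f [measurable]: "case_prod f \<in> borel_measurable (lborel \<Otimes>\<^sub>M lborel)"
    and a: "integrable lborel a" and b: "integrable lborel b"
    and le: "\<And>x y. norm (f x y) \<le> a x * b y"
  shows "integrable (lborel \<Otimes>\<^sub>M lborel) (case_prod f)"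
proof (rule Bochner_Integration.integrable_bound)
  have [measurable]: "a \<in> borel_measurable lborel" "b \<in> borel_measurable lborel"
    using a b by auto
  show "integrable (lborel \<Otimes>\<^sub>M lborel) (\<lambda>(x, y). a x * b y)"
  proof (rule lborel_pair.Fubini_integrable)
    show "(\<lambda>(x, y). a x * b y) \<in> borel_measurable (lborel \<Otimes>\<^sub>M lborel)" by measurable
    show "integrable lborel (\<lambda>x. \<integral>y. norm (case (x, y) of (x, y) \<Rightarrow> a x * b y) \<partial>lborel)"
      using a b by (simp add: abs_mult)
    show "AE x in lborel. integrable lborel (\<lambda>y. case (x, y) of (x, y) \<Rightarrow> a x * b y)"
      using b by simp
  qed
  show "case_prod f \<in> borel_measurable (lborel \<Otimes>\<^sub>M lborel)" by measurable
  show "AE p in lborel \<Otimes>\<^sub>M lborel. norm (case_prod f p) \<le> norm (case p of (x, y) \<Rightarrow> a x * b y)"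
    by (intro AE_I2) (auto simp: split_beta intro: order_trans[OF le])
qed

lemma lborel_integral_swap:
  fixes f :: "real \<Rightarrow> real \<Rightarrow> complex"
  assumes "case_prod f \<in> borel_measurable (lborel \<Otimes>\<^sub>M lborel)"
    and "integrable lborel a" and "integrable lborel b"
    and "\<And>x y. norm (f x y) \<le> a x * b y"
  shows "(LBINT x. LBINT y. f x y) = (LBINT y. LBINT x. f x y)"
  using lborel_pair.Fubini_integral[OF integrable_lborel_product[OF assms]] by simp

section \<open>Symbols stable under the Picard iteration\<close>

text \<open>This class contains the indicator profiles used at the end and is closed under every operation
that the Picard iterate performs on the Fourier side. Smoothness would not be preserved: the factor
\<open>cis (phi \<gamma> \<xi> * \<tau>)\<close> has an essential singularity at \<open>\<xi> = 0\<close>. Almost everywhere continuity is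
preserved, and it is what the Gaussian summation argument for inversion and Plancherel needs.\<close>
definition tame :: "(real \<Rightarrow> complex) \<Rightarrow> bool" where
  "tame m \<longleftrightarrow> m \<in> borel_measurable borel \<and> (AE x in lborel. isCont m x) \<and>
     (\<exists>B R. \<forall>x. norm (m x) \<le> B * indicator {-R..R} x)"

lemma tame_measurable: "tame m \<Longrightarrow> m \<in> borel_measurable borel"
  and tame_AE_cont: "tame m \<Longrightarrow> AE x in lborel. isCont m x"
  by (auto simp: tame_def)

lemma tame_bound:
  assumes "tame m"
  obtains B R where "0 \<le> B" "0 \<le> R" "\<And>x. norm (m x) \<le> B * indicator {-R..R} x"
    "\<And>x. norm (m x) \<le> B"
proof -
  obtain B R where *: "\<And>x. norm (m x) \<le> B * indicator {-R..R} x"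
    using assms unfolding tame_def by blast
  have "norm (m x) \<le> \<bar>B\<bar> * indicator {-\<bar>R\<bar>..\<bar>R\<bar>} x" for x
    by (rule order_trans[OF *]) (auto simp: indicator_def abs_if split: if_splits)
  moreover from this have "norm (m x) \<le> \<bar>B\<bar>" for x
    by (rule order_trans) (auto simp: indicator_def)
  ultimately show ?thesis by (intro that[of "\<bar>B\<bar>" "\<bar>R\<bar>"]) auto
qed

lemma integrable_box: "integrable lborel (\<lambda>x. B * indicator {-R..R::real} x :: real)"
  by (intro integrable_mult_right integrable_real_indicator) (auto simp: emeasure_lborel_Icc_eq)

lemma tame_integrable: assumes "tame m" shows "integrable lborel m"
proof -
  obtain B R where B: "\<And>x. norm (m x) \<le> B * indicator {-R..R} x" "0 \<le> B" using tame_bound[OF assms] by metis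
  show ?thesis
    by (rule Bochner_Integration.integrable_bound[OF integrable_box[of B R]])
       (use B tame_measurable[OF assms] in \<open>auto\<close>)
qed

lemma tame_mult:
  assumes m: "tame m" and c: "c \<in> borel_measurable borel" "AE x in lborel. isCont c x"
    and b: "\<And>R. \<exists>K. \<forall>x\<in>{-R..R}. norm (c x) \<le> K"
  shows "tame (\<lambda>x. c x * m x)"
proof -
  note [measurable] = tame_measurable[OF m] c(1)
  obtain B R where B: "\<And>x. norm (m x) \<le> B * indicator {-R..R} x" using tame_bound[OF m] by metis
  obtain K where K: "\<forall>x\<in>{-R..R}. norm (c x) \<le> K" using b by blast
  have "norm (c x * m x) \<le> (K * B) * indicator {-R..R} x" for x
    using mult_mono[of "norm (c x)" K "norm (m x)" B] K B[of x] order_trans[OF norm_ge_zero[of "c x"], of K]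
    by (cases "x \<in> {-R..R}") (auto simp: norm_mult)
  moreover have "AE x in lborel. isCont (\<lambda>x. c x * m x) x"
    using c(2) tame_AE_cont[OF m] by eventually_elim (intro continuous_intros)
  ultimately show ?thesis unfolding tame_def by (auto intro!: exI)
qed

lemma tame_mult_continuous:
  assumes m: "tame m" and c: "\<And>x. isCont c x"
  shows "tame (\<lambda>x. c x * m x)"
proof (rule tame_mult[OF m])
  have cc: "continuous_on T c" for T using c by (simp add: continuous_at_imp_continuous_on)
  then show "c \<in> borel_measurable borel" by (intro borel_measurable_continuous_onI)
  have "bounded (c ` {-R..R})" for R
    by (intro compact_imp_bounded compact_continuous_image cc) auto
  then show "\<exists>K. \<forall>x\<in>{-R..R}. norm (c x) \<le> K" for R
    unfolding bounded_iff by blast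
qed (use c in auto)

text \<open>The inverse Fourier transform in the normalisation where \<open>fourier_integral\<close> carries the factor
\<open>1 / (2 * pi)\<close>.\<close>
definition synth :: "(real \<Rightarrow> complex) \<Rightarrow> real \<Rightarrow> complex" where
  "synth m x = (LBINT \<xi>. cis (x * \<xi>) * m \<xi>)"

lemma integrable_cis_mult:
  assumes "integrable lborel (m :: real \<Rightarrow> complex)" "f \<in> borel_measurable borel"
  shows "integrable lborel (\<lambda>\<xi>. cis (f \<xi>) * m \<xi>)"
  by (rule Bochner_Integration.integrable_bound[OF assms(1)])
     (use assms borel_measurable_integrable[OF assms(1)] in \<open>auto simp: norm_mult\<close>)

lemma fourier_integral_eq_synth: "fourier_integral f \<xi> = complex_of_real (1 / (2 * pi)) * synth f (- \<xi>)"
  unfolding fourier_integral_def synth_def by (simp add: mult.commute)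

lemma inv_fourier_eq_synth: "integrable lborel F \<Longrightarrow> inv_fourier F = synth F"
  unfolding inv_fourier_def fourier_def by (auto simp: fourier_integral_eq_synth)

lemma synth_cong_AE:
  assumes "AE \<xi> in lborel. m \<xi> = m' \<xi>" "m \<in> borel_measurable borel" "m' \<in> borel_measurable borel"
  shows "synth m = synth m'"
  unfolding synth_def by (intro ext integral_cong_AE) (use assms in \<open>auto elim: eventually_mono\<close>)

lemma synth_measurable [measurable]:
  assumes [measurable]: "m \<in> borel_measurable borel"
  shows "synth m \<in> borel_measurable borel"
proof -
  have "(\<lambda>x. LBINT \<xi>. cis (x * \<xi>) * m \<xi>) \<in> borel_measurable borel"
    by (rule lborel.borel_measurable_lebesgue_integral) measurable
  then show ?thesis by (simp add: synth_def[abs_def])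
qed

lemma synth_bounded:
  assumes "integrable lborel m"
  shows "norm (synth m x) \<le> (LBINT \<xi>. norm (m \<xi>))"
  unfolding synth_def by (rule order_trans[OF integral_norm_bound]) (simp add: norm_mult)

lemma synth_isCont:
  assumes "integrable lborel m"
  shows "isCont (synth m) x"
proof -
  note [measurable] = borel_measurable_integrable[OF assms]
  have "(synth m \<longlongrightarrow> synth m x) (at x)"
    unfolding tendsto_at_iff_sequentially synth_def[abs_def] comp_def
  proof (intro allI impI)
    fix X assume "\<forall>i. X i \<in> UNIV - {x}" and X: "X \<longlonglongrightarrow> x"
    show "(\<lambda>n. LBINT \<xi>. cis (X n * \<xi>) * m \<xi>) \<longlonglongrightarrow> (LBINT \<xi>. cis (x * \<xi>) * m \<xi>)"
    proof (rule integral_dominated_convergence[where w="\<lambda>\<xi>. norm (m \<xi>)"])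
      show "AE \<xi> in lborel. (\<lambda>n. cis (X n * \<xi>) * m \<xi>) \<longlonglongrightarrow> cis (x * \<xi>) * m \<xi>"
        by (intro AE_I2 tendsto_intros) (auto simp: cis_conv_exp intro!: tendsto_intros X)
    qed (use assms in \<open>auto simp: norm_mult\<close>)
  qed
  then show ?thesis by (simp add: isCont_def)
qed

section \<open>Inversion and Plancherel by Gaussian summation\<close>

definition gauss :: "real \<Rightarrow> real \<Rightarrow> real" where
  "gauss \<epsilon> x = exp (- ((\<epsilon> * x)\<^sup>2 / 2))"

lemma gauss_measurable [measurable]: "gauss \<epsilon> \<in> borel_measurable borel"
  unfolding gauss_def[abs_def] by measurable

lemma gauss_eq_density: "gauss \<epsilon> x = sqrt (2 * pi) * std_normal_density (\<epsilon> * x)"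
  by (simp add: gauss_def normal_density_def)

lemma gauss_bounds: "0 < gauss \<epsilon> x" "gauss \<epsilon> x \<le> 1" "\<bar>gauss \<epsilon> x\<bar> \<le> 1"
  by (auto simp: gauss_def)

lemma gauss_integrable: "\<epsilon> > 0 \<Longrightarrow> integrable lborel (gauss \<epsilon>)"
  unfolding gauss_eq_density[abs_def]
  using lborel_integrable_real_affine[of std_normal_density \<epsilon> 0] integrable_normal_density[of 1 0]
  by auto

lemma synth_gauss:
  assumes "\<epsilon> > 0"
  shows "synth (\<lambda>x. complex_of_real (gauss \<epsilon> x)) u = complex_of_real (2 * pi / \<epsilon> * std_normal_density (u / \<epsilon>))"
proof -
  have "complex_of_real (exp (- ((u/\<epsilon>)\<^sup>2) / 2)) = char std_normal_distribution (u/\<epsilon>)"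
    by (simp add: char_std_normal_distribution)
  also have "\<dots> = (LBINT x. std_normal_density x *\<^sub>R iexp (u/\<epsilon> * x))"
    unfolding char_def by (subst integral_density) (auto simp: normal_density_nonneg)
  also have "\<dots> = \<bar>\<epsilon>\<bar> *\<^sub>R (LBINT x. std_normal_density (0 + \<epsilon> * x) *\<^sub>R iexp (u/\<epsilon> * (0 + \<epsilon> * x)))"
    using assms by (intro lborel_integral_real_affine) auto
  also have "(LBINT x. std_normal_density (0 + \<epsilon> * x) *\<^sub>R iexp (u/\<epsilon> * (0 + \<epsilon> * x)))
     = (LBINT x. complex_of_real (1 / sqrt (2 * pi)) * (cis (u * x) * complex_of_real (gauss \<epsilon> x)))"
    using assms by (intro Bochner_Integration.integral_cong refl)
      (auto simp: gauss_eq_density scaleR_conv_of_real cis_conv_exp mult_ac)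
  also have "\<dots> = complex_of_real (1 / sqrt (2 * pi)) * synth (\<lambda>x. complex_of_real (gauss \<epsilon> x)) u"
    unfolding synth_def by (simp only: integral_mult_right_zero)
  finally have eq: "complex_of_real (exp (- ((u/\<epsilon>)\<^sup>2) / 2)) =
     \<bar>\<epsilon>\<bar> *\<^sub>R (complex_of_real (1 / sqrt (2 * pi)) * synth (\<lambda>x. complex_of_real (gauss \<epsilon> x)) u)" .
  have "complex_of_real (sqrt (2*pi) / \<epsilon>) * complex_of_real (exp (- ((u/\<epsilon>)\<^sup>2) / 2)) =
     synth (\<lambda>x. complex_of_real (gauss \<epsilon> x)) u"
    unfolding eq using assms by (simp add: scaleR_conv_of_real field_simps)
  moreover have "sqrt (2*pi) / \<epsilon> * exp (- ((u/\<epsilon>)\<^sup>2) / 2) = 2 * pi / \<epsilon> * std_normal_density (u / \<epsilon>)"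
    using assms by (simp add: normal_density_def field_simps flip: real_sqrt_mult)
  ultimately show ?thesis by (metis of_real_mult)
qed

text \<open>Multiplying \<open>synth m\<close> by a Gaussian makes its inverse transform absolutely convergent; Fubini and
the known transform of the Gaussian turn it into the average of \<open>m\<close> over a normal law centred at
\<open>\<xi>\<close> with standard deviation \<open>\<epsilon>\<close>. Both the inversion formula and Plancherel's identity are obtained
from this formula as \<open>\<epsilon>\<close> tends to 0.\<close>
lemma gauss_mean_synth:
  assumes m: "tame m" and \<epsilon>: "\<epsilon> > 0"
  shows "synth (\<lambda>x. complex_of_real (gauss \<epsilon> x) * synth m x) (- \<xi>) =
    complex_of_real (2 * pi) * (LBINT z. complex_of_real (std_normal_density z) * m (\<xi> + \<epsilon> * z))"
proof -
  note [measurable] = tame_measurable[OF m]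
  have "synth (\<lambda>x. complex_of_real (gauss \<epsilon> x) * synth m x) (- \<xi>) =
     (LBINT x. LBINT \<eta>. cis (- \<xi> * x) * (complex_of_real (gauss \<epsilon> x) * (cis (x * \<eta>) * m \<eta>)))"
    unfolding synth_def by simp
  also have "\<dots> = (LBINT \<eta>. LBINT x. cis (- \<xi> * x) * (complex_of_real (gauss \<epsilon> x) * (cis (x * \<eta>) * m \<eta>)))"
    by (rule lborel_integral_swap[OF _ gauss_integrable[OF \<epsilon>] integrable_norm[OF tame_integrable[OF m]]])
       (use gauss_bounds(1) in \<open>auto simp: norm_mult less_imp_le\<close>)
  also have "\<dots> = (LBINT \<eta>. synth (\<lambda>x. complex_of_real (gauss \<epsilon> x)) (\<eta> - \<xi>) * m \<eta>)"
  proof (intro Bochner_Integration.integral_cong refl)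
    fix \<eta>
    have "(LBINT x. cis (- \<xi> * x) * (complex_of_real (gauss \<epsilon> x) * (cis (x * \<eta>) * m \<eta>)))
        = (LBINT x. (cis ((\<eta> - \<xi>) * x) * complex_of_real (gauss \<epsilon> x)) * m \<eta>)"
    proof (intro Bochner_Integration.integral_cong refl)
      fix x
      have "cis ((\<eta> - \<xi>) * x) = cis (- \<xi> * x) * cis (x * \<eta>)" by (simp add: cis_mult algebra_simps)
      then show "cis (- \<xi> * x) * (complex_of_real (gauss \<epsilon> x) * (cis (x * \<eta>) * m \<eta>)) =
         (cis ((\<eta> - \<xi>) * x) * complex_of_real (gauss \<epsilon> x)) * m \<eta>" by simp
    qed
    then show "(LBINT x. cis (- \<xi> * x) * (complex_of_real (gauss \<epsilon> x) * (cis (x * \<eta>) * m \<eta>))) =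
       synth (\<lambda>x. complex_of_real (gauss \<epsilon> x)) (\<eta> - \<xi>) * m \<eta>"
      unfolding synth_def by simp
  qed
  also have "\<dots> = (LBINT \<eta>. complex_of_real (2 * pi / \<epsilon> * std_normal_density ((\<eta> - \<xi>) / \<epsilon>)) * m \<eta>)"
    by (simp only: synth_gauss[OF \<epsilon>])
  also have "\<dots> = \<bar>\<epsilon>\<bar> *\<^sub>R (LBINT z. complex_of_real (2 * pi / \<epsilon> * std_normal_density ((\<xi> + \<epsilon> * z - \<xi>) / \<epsilon>)) * m (\<xi> + \<epsilon> * z))"
    using \<epsilon> by (intro lborel_integral_real_affine) auto
  also have "\<dots> = \<bar>\<epsilon>\<bar> *\<^sub>R (LBINT z. complex_of_real (2 * pi / \<epsilon>) * (complex_of_real (std_normal_density z) * m (\<xi> + \<epsilon> * z)))"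
    using \<epsilon> by (simp add: mult_ac)
  also have "\<dots> = complex_of_real (2 * pi) * (LBINT z. complex_of_real (std_normal_density z) * m (\<xi> + \<epsilon> * z))"
    using \<epsilon> by (simp add: scaleR_conv_of_real)
  finally show ?thesis .
qed

lemma gauss_mean_bound:
  assumes "\<And>x. norm (m x) \<le> B" "0 \<le> B" "m \<in> borel_measurable borel"
  shows "integrable lborel (\<lambda>z. complex_of_real (std_normal_density z) * m (\<xi> + \<epsilon> * z))"
    and "norm (LBINT z. complex_of_real (std_normal_density z) * m (\<xi> + \<epsilon> * z)) \<le> B"
proof -
  note [measurable] = assms(3)
  have i: "integrable lborel (\<lambda>z. B * std_normal_density z)" by auto
  have le: "norm (complex_of_real (std_normal_density z) * m (\<xi> + \<epsilon> * z)) \<le> B * std_normal_density z" for z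
    using mult_left_mono[OF assms(1)[of "\<xi> + \<epsilon> * z"], of "std_normal_density z"]
    by (simp add: norm_mult mult.commute normal_density_nonneg)
  show int: "integrable lborel (\<lambda>z. complex_of_real (std_normal_density z) * m (\<xi> + \<epsilon> * z))"
    by (rule Bochner_Integration.integrable_bound[OF i])
       (use le in \<open>auto intro!: AE_I2 intro: order_trans[OF _ abs_ge_self]\<close>)
  have "norm (LBINT z. complex_of_real (std_normal_density z) * m (\<xi> + \<epsilon> * z)) \<le> (LBINT z. B * std_normal_density z)"
    by (rule order_trans[OF integral_norm_bound integral_mono[OF integrable_norm[OF int] i le]])
  then show "norm (LBINT z. complex_of_real (std_normal_density z) * m (\<xi> + \<epsilon> * z)) \<le> B" by simp
qed

lemma gauss_mean_tendsto:
  assumes "\<And>x. norm (m x) \<le> B" "m \<in> borel_measurable borel" "isCont m \<xi>"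
    and e: "e \<longlonglongrightarrow> 0"
  shows "(\<lambda>n. LBINT z. complex_of_real (std_normal_density z) * m (\<xi> + e n * z)) \<longlonglongrightarrow> m \<xi>"
proof -
  note [measurable] = assms(2)
  have "(\<lambda>n. LBINT z. complex_of_real (std_normal_density z) * m (\<xi> + e n * z))
     \<longlonglongrightarrow> (LBINT z. complex_of_real (std_normal_density z) * m \<xi>)"
  proof (rule integral_dominated_convergence[where w="\<lambda>z. std_normal_density z * B"])
    show "AE z in lborel. (\<lambda>n. complex_of_real (std_normal_density z) * m (\<xi> + e n * z))
         \<longlonglongrightarrow> complex_of_real (std_normal_density z) * m \<xi>"
    proof (intro AE_I2 tendsto_intros)
      fix z
      have "(\<lambda>n. \<xi> + e n * z) \<longlonglongrightarrow> \<xi> + 0 * z" by (intro tendsto_intros e)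
      then show "(\<lambda>n. m (\<xi> + e n * z)) \<longlonglongrightarrow> m \<xi>"
        using isCont_tendsto_compose[OF assms(3)] by simp
    qed
    show "AE z in lborel. norm (complex_of_real (std_normal_density z) * m (\<xi> + e n * z)) \<le> std_normal_density z * B" for n
      using assms(1) by (intro AE_I2) (auto simp: norm_mult normal_density_nonneg intro!: mult_left_mono)
  qed auto
  moreover have "(LBINT z. complex_of_real (std_normal_density z) * m \<xi>) = m \<xi>" by simp
  ultimately show ?thesis by simp
qed

lemma harmonic_tendsto: "(\<lambda>n. 1 / real (Suc n)) \<longlonglongrightarrow> 0"
  using LIMSEQ_inverse_real_of_nat by (simp add: inverse_eq_divide)

lemma gauss_tendsto: "(\<lambda>n. gauss (1 / real (Suc n)) x) \<longlonglongrightarrow> 1"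
proof -
  have "(\<lambda>n. exp (- ((1 / real (Suc n) * x)\<^sup>2 / 2))) \<longlonglongrightarrow> exp (- ((0 * x)\<^sup>2 / 2))"
    by (intro tendsto_intros harmonic_tendsto) auto
  then show ?thesis by (simp add: gauss_def)
qed

lemma fourier_integral_synth:
  assumes m: "tame m" and int: "integrable lborel (synth m)" and \<xi>: "isCont m \<xi>"
  shows "fourier_integral (synth m) \<xi> = m \<xi>"
proof -
  note [measurable] = tame_measurable[OF m]
  obtain B where B: "\<And>x. norm (m x) \<le> B" using tame_bound[OF m] by metis
  let ?e = "\<lambda>n. 1 / real (Suc n)"
  let ?u = "\<lambda>n. synth (\<lambda>x. complex_of_real (gauss (?e n) x) * synth m x) (- \<xi>)"
  have "?u = (\<lambda>n. complex_of_real (2 * pi) * (LBINT z. complex_of_real (std_normal_density z) * m (\<xi> + ?e n * z)))"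
    by (intro ext gauss_mean_synth[OF m]) auto
  also have "\<dots> \<longlonglongrightarrow> complex_of_real (2 * pi) * m \<xi>"
    by (intro tendsto_mult_left gauss_mean_tendsto[OF B _ \<xi>] harmonic_tendsto) measurable
  finally have 1: "?u \<longlonglongrightarrow> complex_of_real (2 * pi) * m \<xi>" .
  have "?u \<longlonglongrightarrow> synth (synth m) (- \<xi>)"
    unfolding synth_def[of "\<lambda>x. complex_of_real (gauss (?e n) x) * synth m x" for n] synth_def[of "synth m"]
  proof (rule integral_dominated_convergence[where w="\<lambda>x. norm (synth m x)"])
    show "AE x in lborel. (\<lambda>n. cis (- \<xi> * x) * (complex_of_real (gauss (?e n) x) * synth m x))
        \<longlonglongrightarrow> cis (- \<xi> * x) * synth m x"
    proof (intro AE_I2)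
      fix x
      have "(\<lambda>n. cis (- \<xi> * x) * (complex_of_real (gauss (?e n) x) * synth m x))
        \<longlonglongrightarrow> cis (- \<xi> * x) * (complex_of_real 1 * synth m x)"
        by (intro tendsto_intros gauss_tendsto)
      then show "(\<lambda>n. cis (- \<xi> * x) * (complex_of_real (gauss (?e n) x) * synth m x))
        \<longlonglongrightarrow> cis (- \<xi> * x) * synth m x" by simp
    qed
    show "AE x in lborel. norm (cis (- \<xi> * x) * (complex_of_real (gauss (?e n) x) * synth m x)) \<le> norm (synth m x)" for n
      using gauss_bounds by (intro AE_I2) (auto simp: norm_mult intro!: mult_left_le_one_le)
  qed (use int in auto)
  then have "synth (synth m) (- \<xi>) = complex_of_real (2 * pi) * m \<xi>"
    using 1 LIMSEQ_unique by blast
  then show ?thesis by (simp add: fourier_integral_eq_synth)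
qed

lemma synth_adjoint:
  assumes h: "integrable lborel h" and m: "integrable lborel m"
  shows "(LBINT x. h x * cnj (synth m x)) = (LBINT \<xi>. cnj (m \<xi>) * synth h (- \<xi>))"
proof -
  note [measurable] = borel_measurable_integrable[OF h] borel_measurable_integrable[OF m]
  have [measurable]: "cnj \<in> borel_measurable borel"
    by (intro borel_measurable_continuous_onI continuous_intros)
  have "(LBINT x. h x * cnj (synth m x)) = (LBINT x. LBINT \<xi>. h x * (cis (- (x * \<xi>)) * cnj (m \<xi>)))"
    unfolding synth_def Bochner_Integration.integral_cnj[symmetric] by (simp add: cis_cnj)
  also have "\<dots> = (LBINT \<xi>. LBINT x. h x * (cis (- (x * \<xi>)) * cnj (m \<xi>)))"
    by (rule lborel_integral_swap[OF _ integrable_norm[OF h] integrable_norm[OF m]])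
       (auto simp: norm_mult)
  also have "\<dots> = (LBINT \<xi>. LBINT x. cnj (m \<xi>) * (cis (- \<xi> * x) * h x))"
    by (intro Bochner_Integration.integral_cong refl) (simp add: mult_ac)
  finally show ?thesis unfolding synth_def by simp
qed

text \<open>The Gaussian-weighted mass of \<open>synth m\<close> increases to the full mass when the weight is removed. By
adjointness and \<open>gauss_mean_synth\<close> it equals the pairing of \<open>m\<close> with a Gaussian average of
\<open>m\<close>, which converges to the mass of \<open>m\<close> because \<open>m\<close> is continuous almost everywhere.\<close>
lemma plancherel_tame:
  assumes m: "tame m"
  shows "(\<integral>\<^sup>+x. ennreal ((norm (synth m x))\<^sup>2) \<partial>lborel) = ennreal (2 * pi * (LBINT \<xi>. (norm (m \<xi>))\<^sup>2))"
proof -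
  note [measurable] = tame_measurable[OF m]
  have [measurable]: "cnj \<in> borel_measurable borel"
    by (intro borel_measurable_continuous_onI continuous_intros)
  obtain B where B: "\<And>x. norm (m x) \<le> B" "0 \<le> B" using tame_bound[OF m] by metis
  note mi = tame_integrable[OF m]
  let ?e = "\<lambda>n. 1 / real (Suc n)"
  let ?C = "LBINT \<xi>. norm (m \<xi>)"
  let ?u = "\<lambda>n x. gauss (?e n) x * (norm (synth m x))\<^sup>2"
  let ?K = "\<lambda>n \<xi>. LBINT z. complex_of_real (std_normal_density z) * m (\<xi> + ?e n * z)"
  have C: "norm (synth m x) \<le> ?C" for x using synth_bounded[OF mi] .
  have C0: "0 \<le> ?C" by simp
  have int: "integrable lborel (?u n)" for n
  proof (rule Bochner_Integration.integrable_bound)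
    show "integrable lborel (\<lambda>x. gauss (?e n) x * ?C\<^sup>2)" by (intro integrable_mult_left gauss_integrable) auto
    show "AE x in lborel. norm (?u n x) \<le> norm (gauss (?e n) x * ?C\<^sup>2)"
      by (intro AE_I2) (auto simp: abs_mult intro!: mult_left_mono power_mono C)
  qed auto
  have intc: "integrable lborel (\<lambda>x. complex_of_real (gauss (?e n) x) * synth m x)" for n
  proof (rule Bochner_Integration.integrable_bound)
    show "integrable lborel (\<lambda>x. gauss (?e n) x * ?C)" by (intro integrable_mult_left gauss_integrable) auto
    show "AE x in lborel. norm (complex_of_real (gauss (?e n) x) * synth m x) \<le> norm (gauss (?e n) x * ?C)"
      by (intro AE_I2) (auto simp: abs_mult norm_mult intro!: mult_left_mono C)
  qed auto
  have eq: "complex_of_real (integral\<^sup>L lborel (?u n)) = (LBINT \<xi>. cnj (m \<xi>) * (complex_of_real (2 * pi) * ?K n \<xi>))" for n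
  proof -
    have "complex_of_real (integral\<^sup>L lborel (?u n)) =
       (LBINT x. (complex_of_real (gauss (?e n) x) * synth m x) * cnj (synth m x))"
      by (subst integral_complex_of_real[symmetric], intro Bochner_Integration.integral_cong refl)
         (simp add: complex_norm_square mult.assoc del: of_real_power)
    also have "\<dots> = (LBINT \<xi>. cnj (m \<xi>) * (complex_of_real (2 * pi) * ?K n \<xi>))"
      by (subst synth_adjoint[OF intc mi], subst gauss_mean_synth[OF m]) auto
    finally show ?thesis .
  qed
  have "(\<lambda>n. LBINT \<xi>. cnj (m \<xi>) * (complex_of_real (2 * pi) * ?K n \<xi>)) \<longlonglongrightarrow>
      (LBINT \<xi>. cnj (m \<xi>) * (complex_of_real (2 * pi) * m \<xi>))"
  proof (rule integral_dominated_convergence[where w="\<lambda>\<xi>. norm (m \<xi>) * (2 * pi * B)"])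
    show "integrable lborel (\<lambda>\<xi>. norm (m \<xi>) * (2 * pi * B))" using mi by simp
    show "AE \<xi> in lborel. (\<lambda>n. cnj (m \<xi>) * (complex_of_real (2 * pi) * ?K n \<xi>))
       \<longlonglongrightarrow> cnj (m \<xi>) * (complex_of_real (2 * pi) * m \<xi>)"
      using tame_AE_cont[OF m]
      by eventually_elim (intro tendsto_mult_left gauss_mean_tendsto[OF B(1)] harmonic_tendsto, auto)
    show "AE \<xi> in lborel. norm (cnj (m \<xi>) * (complex_of_real (2 * pi) * ?K n \<xi>)) \<le> norm (m \<xi>) * (2 * pi * B)" for n
    proof (intro AE_I2)
      fix \<xi>
      have "norm (?K n \<xi>) \<le> B" by (rule gauss_mean_bound[OF B]) auto
      then show "norm (cnj (m \<xi>) * (complex_of_real (2 * pi) * ?K n \<xi>)) \<le> norm (m \<xi>) * (2 * pi * B)"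
        unfolding norm_mult complex_mod_cnj by (intro mult_left_mono) auto
    qed
    show "(\<lambda>\<xi>. cnj (m \<xi>) * (complex_of_real (2 * pi) * ?K n \<xi>)) \<in> borel_measurable lborel" for n
      by (intro borel_measurable_times lborel.borel_measurable_lebesgue_integral) measurable
  qed auto
  moreover have "(LBINT \<xi>. cnj (m \<xi>) * (complex_of_real (2 * pi) * m \<xi>)) =
     complex_of_real (2 * pi * (LBINT \<xi>. (norm (m \<xi>))\<^sup>2))"
  proof -
    have "(LBINT \<xi>. cnj (m \<xi>) * (complex_of_real (2 * pi) * m \<xi>)) =
       (LBINT \<xi>. complex_of_real (2 * pi * (norm (m \<xi>))\<^sup>2))"
      by (intro Bochner_Integration.integral_cong refl) (simp add: complex_norm_square mult_ac del: of_real_power)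
    also have "\<dots> = complex_of_real (2 * pi * (LBINT \<xi>. (norm (m \<xi>))\<^sup>2))"
      by (subst integral_complex_of_real) simp
    finally show ?thesis .
  qed
  ultimately have "(\<lambda>n. complex_of_real (integral\<^sup>L lborel (?u n))) \<longlonglongrightarrow>
      complex_of_real (2 * pi * (LBINT \<xi>. (norm (m \<xi>))\<^sup>2))" unfolding eq by simp
  then have "(\<lambda>n. integral\<^sup>L lborel (?u n)) \<longlonglongrightarrow> 2 * pi * (LBINT \<xi>. (norm (m \<xi>))\<^sup>2)"
    by (simp only: tendsto_of_real_iff)
  then have "(\<lambda>n. ennreal (integral\<^sup>L lborel (?u n))) \<longlonglongrightarrow> ennreal (2 * pi * (LBINT \<xi>. (norm (m \<xi>))\<^sup>2))"
    by (rule tendsto_ennrealI)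
  moreover have "ennreal (integral\<^sup>L lborel (?u n)) = (\<integral>\<^sup>+x. ennreal (?u n x) \<partial>lborel)" for n
    by (rule nn_integral_eq_integral[symmetric, OF int]) (auto simp: gauss_def)
  moreover have "(\<lambda>n. \<integral>\<^sup>+x. ennreal (?u n x) \<partial>lborel) \<longlonglongrightarrow> (\<integral>\<^sup>+x. ennreal ((norm (synth m x))\<^sup>2) \<partial>lborel)"
  proof (rule nn_integral_LIMSEQ)
    have "gauss (?e i) x \<le> gauss (?e (Suc i)) x" for i x
      unfolding gauss_def exp_le_cancel_iff neg_le_iff_le power_mult_distrib
      by (intro divide_right_mono mult_right_mono power_mono frac_le) auto
    then show "incseq (\<lambda>n x. ennreal (?u n x))"
      by (intro incseq_SucI le_funI ennreal_leI mult_right_mono) auto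
    show "(\<lambda>n. ennreal (?u n x)) \<longlonglongrightarrow> ennreal ((norm (synth m x))\<^sup>2)" for x
      using tendsto_ennrealI[OF tendsto_mult[OF gauss_tendsto[of x] tendsto_const[of "(norm (synth m x))\<^sup>2"]]]
      by simp
  qed measurable
  ultimately show ?thesis using LIMSEQ_unique by fastforce
qed

lemma square_integrable_synth:
  assumes "tame m" shows "square_integrable (synth m)"
proof -
  note [measurable] = tame_measurable[OF assms]
  show ?thesis
    unfolding square_integrable_def integrable_iff_bounded
    by (auto simp: plancherel_tame[OF assms])
qed

lemma square_integrable_tame:
  assumes "tame m" shows "square_integrable m"
proof -
  note [measurable] = tame_measurable[OF assms]
  obtain B where B: "\<And>x. norm (m x) \<le> B" "0 \<le> B" using tame_bound[OF assms] by metis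
  have "integrable lborel (\<lambda>x. (norm (m x))\<^sup>2)"
    by (rule Bochner_Integration.integrable_bound[OF integrable_mult_right[OF integrable_norm[OF tame_integrable[OF assms]], of B]])
       (use B in \<open>auto simp: power2_eq_square abs_mult intro!: mult_right_mono\<close>)
  then show ?thesis by (simp add: square_integrable_def)
qed

lemma is_plancherel_transform_unique:
  assumes F: "is_plancherel_transform f F" and G: "is_plancherel_transform f G"
    and f: "f \<in> borel_measurable borel"
  shows "AE \<xi> in lborel. F \<xi> = G \<xi>"
proof -
  note [measurable] = f
  have [measurable]: "F \<in> borel_measurable borel" "G \<in> borel_measurable borel"
    using F G by (auto simp: is_plancherel_transform_def square_integrable_def)
  let ?T = "\<lambda>R. fourier_integral (\<lambda>x. indicator {-R..R} x * f x)"
  have [measurable]: "?T R \<in> borel_measurable borel" for R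
    unfolding fourier_integral_eq_synth by measurable
  let ?a = "\<lambda>R. \<integral>\<^sup>+\<xi>. ennreal ((norm (F \<xi> - ?T R \<xi>))\<^sup>2) \<partial>lborel"
  let ?b = "\<lambda>R. \<integral>\<^sup>+\<xi>. ennreal ((norm (G \<xi> - ?T R \<xi>))\<^sup>2) \<partial>lborel"
  let ?I = "\<integral>\<^sup>+\<xi>. ennreal ((norm (F \<xi> - G \<xi>))\<^sup>2) \<partial>lborel"
  have le: "?I \<le> 2 * ?a R + 2 * ?b R" for R
  proof -
    have "?I \<le> (\<integral>\<^sup>+\<xi>. 2 * ennreal ((norm (F \<xi> - ?T R \<xi>))\<^sup>2) + 2 * ennreal ((norm (G \<xi> - ?T R \<xi>))\<^sup>2) \<partial>lborel)"
    proof (intro nn_integral_mono)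
      fix \<xi>
      let ?x = "norm (F \<xi> - ?T R \<xi>)" and ?y = "norm (G \<xi> - ?T R \<xi>)"
      have "norm (F \<xi> - G \<xi>) \<le> ?x + ?y"
        by (metis norm_minus_commute norm_diff_triangle_ineq diff_add_cancel norm_diff_triangle_le order_refl)
      then have "(norm (F \<xi> - G \<xi>))\<^sup>2 \<le> (?x + ?y)\<^sup>2" by (intro power_mono) auto
      also have "\<dots> \<le> 2 * ?x\<^sup>2 + 2 * ?y\<^sup>2" using sum_squares_bound[of ?x ?y] by (simp add: power2_sum)
      finally have "ennreal ((norm (F \<xi> - G \<xi>))\<^sup>2) \<le> ennreal (2 * ?x\<^sup>2 + 2 * ?y\<^sup>2)" by (rule ennreal_leI)
      then show "ennreal ((norm (F \<xi> - G \<xi>))\<^sup>2) \<le> 2 * ennreal (?x\<^sup>2) + 2 * ennreal (?y\<^sup>2)"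
        by (simp add: ennreal_mult)
    qed
    also have "\<dots> = 2 * ?a R + 2 * ?b R"
      by (simp add: nn_integral_add nn_integral_cmult)
    finally show ?thesis .
  qed
  have "((\<lambda>R. 2 * ?a R + 2 * ?b R) \<longlongrightarrow> 2 * 0 + 2 * 0) at_top"
    using F G unfolding is_plancherel_transform_def
    by (intro tendsto_add ennreal_tendsto_cmult) auto
  then have "?I \<le> 2 * 0 + 2 * 0"
    by (rule tendsto_lowerbound) (use le in auto)
  then have "?I = 0" by simp
  then show ?thesis by (subst (asm) nn_integral_0_iff_AE) auto
qed

lemma countable_AE_isCont:
  assumes "countable S" "\<And>x. x \<notin> S \<Longrightarrow> isCont f x"
  shows "AE x::real in lborel. isCont f x"
  using AE_not_in[OF countable_imp_null_set_lborel[OF assms(1)]]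
  by eventually_elim (use assms(2) in auto)

lemma tame_indicator:
  assumes A: "A \<in> sets borel" "A \<subseteq> {-R..R}" "finite (frontier A)"
  shows "tame (indicator A)"
  unfolding tame_def
proof (intro conjI)
  note [measurable] = A(1)
  show "indicator A \<in> borel_measurable borel" by measurable
  have eq: "(indicator A :: real \<Rightarrow> complex) = (\<lambda>x. complex_of_real (indicator A x))"
    by (auto simp: indicator_def)
  show "AE x in lborel. isCont (indicator A :: real \<Rightarrow> complex) x"
  proof (rule countable_AE_isCont)
    show "countable (frontier A)" using A(3) by (rule countable_finite)
    show "isCont (indicator A :: real \<Rightarrow> complex) x" if "x \<notin> frontier A" for x
      unfolding eq using that by (intro continuous_intros) (simp add: isCont_indicator)
  qed
  have "norm (indicator A x :: complex) \<le> 1 * indicator {-R..R} x" for x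
    using A(2) by (auto simp: indicator_def)
  then show "\<exists>B R. \<forall>x. norm (indicator A x :: complex) \<le> B * indicator {-R..R} x" by blast
qed

lemma finite_frontier_Icc: "finite (frontier {a..b::real})"
  by (rule finite_subset[of _ "{a, b}"])
     (use frontier_cbox[of a b] in \<open>auto simp: box_real\<close>)

text \<open>Expanding the square of the distance between \<open>m\<close> and the transform of a truncation of
\<open>synth m\<close>, the cross term equals the mass of the truncation by adjointness, and so does the
transform's own mass by Plancherel. The squared distance is therefore the mass of \<open>m\<close> minus that of
the truncation (up to the factor \<open>2 * pi\<close>), which tends to 0 by Plancherel for \<open>m\<close>.\<close>
lemma is_plancherel_transform_synth:
  assumes m: "tame m"
  shows "is_plancherel_transform (synth m) m"
proof -
  note [measurable] = tame_measurable[OF m]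
  note mi = tame_integrable[OF m]
  let ?W = "synth m"
  let ?h = "\<lambda>R x. indicator {-R..R} x * ?W x"
  let ?F = "\<lambda>R. fourier_integral (?h R)"
  let ?p = "\<lambda>R. LBINT x. (norm (?h R x))\<^sup>2"
  let ?M = "LBINT \<xi>. (norm (m \<xi>))\<^sup>2"
  have [measurable]: "?F R \<in> borel_measurable borel" for R
    unfolding fourier_integral_eq_synth by measurable
  have h: "tame (?h R)" for R
    using tame_mult_continuous[OF tame_indicator[of "{-R..R}" R] synth_isCont[OF mi]]
    by (simp add: finite_frontier_Icc mult.commute)
  have msq: "integrable lborel (\<lambda>\<xi>. (norm (m \<xi>))\<^sup>2)" and Wsq: "integrable lborel (\<lambda>x. (norm (?W x))\<^sup>2)"
    using square_integrable_tame[OF m] square_integrable_synth[OF m] by (auto simp: square_integrable_def)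
  have W_eq: "(LBINT x. (norm (?W x))\<^sup>2) = 2 * pi * ?M"
  proof -
    have "ennreal (LBINT x. (norm (?W x))\<^sup>2) = ennreal (2 * pi * ?M)"
      using plancherel_tame[OF m] nn_integral_eq_integral[OF Wsq] by simp
    then show ?thesis by (subst (asm) ennreal_inj) auto
  qed
  have Fsq: "integrable lborel (\<lambda>\<xi>. (norm (?F R \<xi>))\<^sup>2)"
    and F_eq: "(LBINT \<xi>. (norm (?F R \<xi>))\<^sup>2) = ?p R / (2 * pi)" for R
  proof -
    have sq: "integrable lborel (\<lambda>x. (norm (synth (?h R) x))\<^sup>2)"
      using square_integrable_synth[OF h] by (auto simp: square_integrable_def)
    have "ennreal (LBINT x. (norm (synth (?h R) x))\<^sup>2) = ennreal (2 * pi * ?p R)"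
      using plancherel_tame[OF h] nn_integral_eq_integral[OF sq] by simp
    then have eq: "(LBINT x. (norm (synth (?h R) x))\<^sup>2) = 2 * pi * ?p R" by (subst (asm) ennreal_inj) auto
    have F: "(norm (?F R \<xi>))\<^sup>2 = 1 / (2 * pi)\<^sup>2 * (norm (synth (?h R) (0 + (-1) * \<xi>)))\<^sup>2" for \<xi>
      by (simp add: fourier_integral_eq_synth norm_mult norm_divide power_mult_distrib power_divide)
    show "integrable lborel (\<lambda>\<xi>. (norm (?F R \<xi>))\<^sup>2)"
      unfolding F by (intro integrable_mult_right lborel_integrable_real_affine[OF sq, of "-1" 0]) auto
    have "(LBINT \<xi>. (norm (?F R \<xi>))\<^sup>2) = 1 / (2 * pi)\<^sup>2 * (LBINT \<xi>. (norm (synth (?h R) (0 + (-1) * \<xi>)))\<^sup>2)"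
      unfolding F by (rule integral_mult_right_zero)
    also have "(LBINT \<xi>. (norm (synth (?h R) (0 + (-1) * \<xi>)))\<^sup>2) = 2 * pi * ?p R"
      using lborel_integral_real_affine[of "-1" "\<lambda>x. (norm (synth (?h R) x))\<^sup>2" 0] eq by simp
    finally show "(LBINT \<xi>. (norm (?F R \<xi>))\<^sup>2) = ?p R / (2 * pi)" by (simp add: power2_eq_square)
  qed
  have cross_int: "integrable lborel (\<lambda>\<xi>. cnj (m \<xi>) * ?F R \<xi>)"
    and cross: "(LBINT \<xi>. cnj (m \<xi>) * ?F R \<xi>) = complex_of_real (?p R / (2 * pi))" for R
  proof -
    note hi = tame_integrable[OF h[of R]]
    have [measurable]: "cnj \<in> borel_measurable borel"
      by (intro borel_measurable_continuous_onI continuous_intros)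
    have b: "norm (?F R \<xi>) \<le> 1 / (2 * pi) * (LBINT x. norm (?h R x))" for \<xi>
      using mult_left_mono[OF synth_bounded[OF hi, of "-\<xi>"], of "1 / (2 * pi)"]
      by (simp add: fourier_integral_eq_synth norm_mult norm_divide)
    show "integrable lborel (\<lambda>\<xi>. cnj (m \<xi>) * ?F R \<xi>)"
    proof (rule Bochner_Integration.integrable_bound)
      show "integrable lborel (\<lambda>\<xi>. norm (m \<xi>) * (1 / (2 * pi) * (LBINT x. norm (?h R x))))"
        using mi by (intro integrable_mult_left integrable_norm)
      show "AE \<xi> in lborel. norm (cnj (m \<xi>) * ?F R \<xi>) \<le> norm (norm (m \<xi>) * (1 / (2 * pi) * (LBINT x. norm (?h R x))))"
      proof (intro AE_I2)
        fix \<xi>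
        have "norm (m \<xi>) * norm (?F R \<xi>) \<le> norm (m \<xi>) * (1 / (2 * pi) * (LBINT x. norm (?h R x)))"
          by (intro mult_left_mono b) auto
        then show "norm (cnj (m \<xi>) * ?F R \<xi>) \<le> norm (norm (m \<xi>) * (1 / (2 * pi) * (LBINT x. norm (?h R x))))"
          unfolding norm_mult complex_mod_cnj real_norm_def by linarith
      qed
    qed measurable
    have "(LBINT \<xi>. cnj (m \<xi>) * ?F R \<xi>) = complex_of_real (1 / (2 * pi)) * (LBINT \<xi>. cnj (m \<xi>) * synth (?h R) (- \<xi>))"
      unfolding fourier_integral_eq_synth mult.left_commute[of "cnj _"] by (rule integral_mult_right_zero)
    also have "\<dots> = complex_of_real (1 / (2 * pi)) * (LBINT x. ?h R x * cnj (?W x))"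
      by (simp only: synth_adjoint[OF hi mi])
    also have "(LBINT x. ?h R x * cnj (?W x)) = (LBINT x. complex_of_real ((norm (?h R x))\<^sup>2))"
      by (intro Bochner_Integration.integral_cong refl)
         (auto simp: complex_norm_square indicator_def simp del: of_real_power)
    also have "\<dots> = complex_of_real (?p R)" by (rule integral_complex_of_real)
    finally show "(LBINT \<xi>. cnj (m \<xi>) * ?F R \<xi>) = complex_of_real (?p R / (2 * pi))" by simp
  qed
  have dist: "(\<integral>\<^sup>+\<xi>. ennreal ((norm (m \<xi> - ?F R \<xi>))\<^sup>2) \<partial>lborel) = ennreal (?M - ?p R / (2 * pi))" for R
  proof -
    have eq: "(norm (m \<xi> - ?F R \<xi>))\<^sup>2 = (norm (m \<xi>))\<^sup>2 + (norm (?F R \<xi>))\<^sup>2 - 2 * Re (cnj (m \<xi>) * ?F R \<xi>)" for \<xi>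
      unfolding cmod_power2 by (simp add: power2_eq_square algebra_simps)
    have int: "integrable lborel (\<lambda>\<xi>. (norm (m \<xi> - ?F R \<xi>))\<^sup>2)"
      unfolding eq by (intro Bochner_Integration.integrable_diff Bochner_Integration.integrable_add msq Fsq
          integrable_mult_right integrable_Re cross_int)
    have "(LBINT \<xi>. (norm (m \<xi> - ?F R \<xi>))\<^sup>2) = ?M + ?p R / (2 * pi) - 2 * (LBINT \<xi>. Re (cnj (m \<xi>) * ?F R \<xi>))"
      unfolding eq
      by (subst Bochner_Integration.integral_diff Bochner_Integration.integral_add,
          (intro Bochner_Integration.integrable_add msq Fsq integrable_mult_right integrable_Re cross_int)+)+
         (simp only: F_eq integral_mult_right_zero)
    also have "(LBINT \<xi>. Re (cnj (m \<xi>) * ?F R \<xi>)) = ?p R / (2 * pi)"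
      by (subst integral_Re[OF cross_int]) (simp only: cross Re_complex_of_real)
    finally show ?thesis using nn_integral_eq_integral[OF int] by simp
  qed
  have "(?p \<longlongrightarrow> (LBINT x. (norm (?W x))\<^sup>2)) at_top"
  proof (rule integral_dominated_convergence_at_top[where w="\<lambda>x. (norm (?W x))\<^sup>2"])
    show "\<forall>\<^sub>F R in at_top. AE x in lborel. norm ((norm (?h R x))\<^sup>2) \<le> (norm (?W x))\<^sup>2"
      by (intro always_eventually allI AE_I2) (auto simp: indicator_def)
    show "AE x in lborel. ((\<lambda>R. (norm (?h R x))\<^sup>2) \<longlongrightarrow> (norm (?W x))\<^sup>2) at_top"
    proof (intro AE_I2 tendsto_eventually)
      fix x show "\<forall>\<^sub>F R in at_top. (norm (?h R x))\<^sup>2 = (norm (?W x))\<^sup>2"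
        using eventually_ge_at_top[of "\<bar>x\<bar>"] by eventually_elim (auto simp: indicator_def)
    qed
  qed (use Wsq in auto)
  then have "((\<lambda>R. ?M - ?p R / (2 * pi)) \<longlongrightarrow> ?M - (2 * pi * ?M) / (2 * pi)) at_top"
    unfolding W_eq by (intro tendsto_intros) auto
  then have "((\<lambda>R. ennreal (?M - ?p R / (2 * pi))) \<longlongrightarrow> ennreal 0) at_top"
    by (intro tendsto_ennrealI) simp
  then show ?thesis
    unfolding is_plancherel_transform_def dist using square_integrable_tame[OF m] by simp
qed

text \<open>The definition of \<open>fourier\<close> branches on integrability, and for a tame \<open>m\<close> either branch can occur:
\<open>synth m\<close> decays only like \<open>1 / x\<close> when \<open>m\<close> jumps. Both branches recover \<open>m\<close>, so
\<open>synth\<close> and \<open>fourier\<close> can be cancelled without deciding which one applies.\<close>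
lemma fourier_synth:
  assumes m: "tame m"
  shows "AE \<xi> in lborel. fourier (synth m) \<xi> = m \<xi>"
    and "fourier (synth m) \<in> borel_measurable borel"
proof -
  note [measurable] = tame_measurable[OF m]
  have "(AE \<xi> in lborel. fourier (synth m) \<xi> = m \<xi>) \<and> fourier (synth m) \<in> borel_measurable borel"
  proof (cases "integrable lborel (synth m)")
    case True
    have "fourier (synth m) = fourier_integral (synth m)" using True by (simp add: fourier_def)
    moreover have "fourier_integral (synth m) \<in> borel_measurable borel"
      unfolding fourier_integral_eq_synth by measurable
    moreover have "AE \<xi> in lborel. fourier_integral (synth m) \<xi> = m \<xi>"
      using tame_AE_cont[OF m] by eventually_elim (rule fourier_integral_synth[OF m True])
    ultimately show ?thesis by simp
  next
    case False
    have F: "fourier (synth m) = (SOME F. is_plancherel_transform (synth m) F)"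
      using False square_integrable_synth[OF m] by (simp add: fourier_def)
    have "is_plancherel_transform (synth m) (fourier (synth m))"
      unfolding F by (rule someI[of _ m]) (rule is_plancherel_transform_synth[OF m])
    then show ?thesis
      using is_plancherel_transform_unique[OF _ is_plancherel_transform_synth[OF m]]
      by (auto simp: is_plancherel_transform_def square_integrable_def)
  qed
  then show "AE \<xi> in lborel. fourier (synth m) \<xi> = m \<xi>" "fourier (synth m) \<in> borel_measurable borel"
    by auto
qed

section \<open>The Picard iterate on the Fourier side\<close>

lemma sobolev_norm_synth:
  assumes "tame m"
  shows "sobolev_norm s (synth m) =
     (let I = \<integral>\<^sup>+ \<xi>. ennreal ((1 + \<xi>\<^sup>2) powr s * (norm (m \<xi>))\<^sup>2) \<partial>lborel
      in if I = \<infinity> then \<infinity> else ennreal (sqrt (enn2real I)))"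
proof -
  have "(\<integral>\<^sup>+ \<xi>. ennreal ((1 + \<xi>\<^sup>2) powr s * (norm (fourier (synth m) \<xi>))\<^sup>2) \<partial>lborel)
      = (\<integral>\<^sup>+ \<xi>. ennreal ((1 + \<xi>\<^sup>2) powr s * (norm (m \<xi>))\<^sup>2) \<partial>lborel)"
    by (rule nn_integral_cong_AE) (use fourier_synth(1)[OF assms] in eventually_elim, simp)
  then show ?thesis unfolding sobolev_norm_def by simp
qed

definition autoconv :: "(real \<Rightarrow> complex) \<Rightarrow> real \<Rightarrow> complex" where
  "autoconv m \<xi> = (LBINT \<eta>. m \<eta> * m (\<xi> - \<eta>))"

lemma autoconv_bound:
  assumes b: "\<And>x. norm (m x) \<le> B * indicator {-R..R} x" and B: "0 \<le> B" and [measurable]: "m \<in> borel_measurable borel"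
  shows "integrable lborel (\<lambda>\<eta>. m \<eta> * m (\<xi> - \<eta>))"
    and "norm (autoconv m \<xi>) \<le> (LBINT \<eta>. B * B * indicator {-R..R::real} \<eta>) * indicator {-(2*R)..2*R} \<xi>"
proof -
  let ?f = "\<lambda>\<eta>. m \<eta> * m (\<xi> - \<eta>)"
  have m0: "m x = 0" if "x \<notin> {-R..R}" for x using b[of x] that by simp
  have B': "norm (m x) \<le> B" for x using order_trans[OF b[of x]] B by (simp add: indicator_def)
  have le: "norm (?f \<eta>) \<le> B * B * indicator {-R..R} \<eta>" for \<eta>
    using mult_mono[OF b[of \<eta>] B'[of "\<xi> - \<eta>"]] B by (simp add: norm_mult mult_ac)
  show int: "integrable lborel ?f"
    by (rule Bochner_Integration.integrable_bound[OF integrable_box[of "B * B" R]])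
       (use le B in \<open>auto simp: abs_mult\<close>)
  have 1: "norm (autoconv m \<xi>) \<le> (LBINT \<eta>. B * B * indicator {-R..R::real} \<eta>)"
    unfolding autoconv_def
    by (rule order_trans[OF integral_norm_bound integral_mono[OF integrable_norm[OF int] integrable_box le]])
  have 2: "autoconv m \<xi> = 0" if "\<xi> \<notin> {-(2*R)..2*R}"
  proof -
    have "?f = (\<lambda>_. 0)"
    proof
      fix \<eta>
      have "\<eta> \<notin> {-R..R} \<or> \<xi> - \<eta> \<notin> {-R..R}" using that by auto
      then show "?f \<eta> = 0" using m0 by auto
    qed
    then show ?thesis unfolding autoconv_def by simp
  qed
  show "norm (autoconv m \<xi>) \<le> (LBINT \<eta>. B * B * indicator {-R..R::real} \<eta>) * indicator {-(2*R)..2*R} \<xi>"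
  proof (cases "\<xi> \<in> {-(2*R)..2*R}")
    case True
    then show ?thesis using 1 by (simp only: indicator_simps mult_1_right)
  next
    case False
    then show ?thesis using 2 by (simp only: indicator_simps mult_zero_right norm_zero order_refl simp_thms)
  qed
qed

lemma autoconv_measurable [measurable]:
  assumes [measurable]: "m \<in> borel_measurable borel"
  shows "autoconv m \<in> borel_measurable borel"
proof -
  have "(\<lambda>\<xi>. LBINT \<eta>. m \<eta> * m (\<xi> - \<eta>)) \<in> borel_measurable borel"
    by (rule lborel.borel_measurable_lebesgue_integral) measurable
  then show ?thesis by (simp add: autoconv_def[abs_def])
qed

text \<open>Convolution removes the jumps: for fixed \<open>\<xi>\<close>, the points \<open>\<eta>\<close> at which \<open>m\<close> fails to be continuous
at \<open>\<xi> - \<eta>\<close> form a null set, so dominated convergence applies.\<close>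
lemma autoconv_isCont:
  assumes m: "tame m" shows "isCont (autoconv m) \<xi>"
proof -
  note [measurable] = tame_measurable[OF m]
  obtain B where B: "\<And>x. norm (m x) \<le> B" using tame_bound[OF m] by metis
  have "(autoconv m \<longlongrightarrow> autoconv m \<xi>) (at \<xi>)"
    unfolding tendsto_at_iff_sequentially autoconv_def[abs_def] comp_def
  proof (intro allI impI)
    fix X assume "\<forall>i. X i \<in> UNIV - {\<xi>}" and X: "X \<longlonglongrightarrow> \<xi>"
    show "(\<lambda>n. LBINT \<eta>. m \<eta> * m (X n - \<eta>)) \<longlonglongrightarrow> (LBINT \<eta>. m \<eta> * m (\<xi> - \<eta>))"
    proof (rule integral_dominated_convergence[where w="\<lambda>\<eta>. norm (m \<eta>) * B"])
      show "AE \<eta> in lborel. (\<lambda>n. m \<eta> * m (X n - \<eta>)) \<longlonglongrightarrow> m \<eta> * m (\<xi> - \<eta>)"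
        using AE_lborel_affine[OF _ tame_AE_cont[OF m], of "-1" \<xi>, simplified]
      proof eventually_elim
        fix \<eta> assume "isCont m (\<xi> - \<eta>)"
        then show "(\<lambda>n. m \<eta> * m (X n - \<eta>)) \<longlonglongrightarrow> m \<eta> * m (\<xi> - \<eta>)"
          by (intro tendsto_mult_left isCont_tendsto_compose[of "\<xi> - \<eta>" m] tendsto_diff X tendsto_const)
      qed
    qed (use B tame_integrable[OF m] in \<open>auto simp: norm_mult intro!: mult_left_mono\<close>)
  qed
  then show ?thesis by (simp add: isCont_def)
qed

lemma tame_autoconv:
  assumes m: "tame m" shows "tame (autoconv m)"
proof -
  note [measurable] = tame_measurable[OF m]
  obtain B R where B: "0 \<le> B" "\<And>x. norm (m x) \<le> B * indicator {-R..R} x" using tame_bound[OF m] by metis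
  show ?thesis
    unfolding tame_def using autoconv_isCont[OF m] autoconv_bound(2)[OF B(2) B(1)] by auto
qed

lemma synth_square:
  assumes m: "tame m" shows "(synth m x)\<^sup>2 = synth (autoconv m) x"
proof -
  note [measurable] = tame_measurable[OF m]
  obtain B R where B: "0 \<le> B" "\<And>x. norm (m x) \<le> B * indicator {-R..R} x"
    using tame_bound[OF m] by metis
  have m0: "m x = 0" if "x \<notin> {-R..R}" for x using B(2)[of x] that by simp
  have "(synth m x)\<^sup>2 = (LBINT \<eta>. cis (x * \<eta>) * m \<eta> * synth m x)"
    unfolding power2_eq_square synth_def[of m x] by (rule integral_mult_left_zero[symmetric])
  also have "\<dots> = (LBINT \<eta>. LBINT \<xi>. cis (x * \<xi>) * (m \<eta> * m (\<xi> - \<eta>)))"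
  proof (intro Bochner_Integration.integral_cong refl)
    fix \<eta>
    have "synth m x = (LBINT \<xi>. cis (x * (\<xi> - \<eta>)) * m (\<xi> - \<eta>))"
      unfolding synth_def
      using lborel_integral_real_affine[of 1 "\<lambda>\<xi>. cis (x * \<xi>) * m \<xi>" "-\<eta>"] by (simp add: add.commute)
    then have "cis (x * \<eta>) * m \<eta> * synth m x = (LBINT \<xi>. cis (x * \<eta>) * m \<eta> * (cis (x * (\<xi> - \<eta>)) * m (\<xi> - \<eta>)))"
      by simp
    also have "\<dots> = (LBINT \<xi>. cis (x * \<xi>) * (m \<eta> * m (\<xi> - \<eta>)))"
    proof (intro Bochner_Integration.integral_cong refl)
      fix \<xi>
      have "cis (x * \<xi>) = cis (x * \<eta>) * cis (x * (\<xi> - \<eta>))" by (simp add: cis_mult algebra_simps)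
      then show "cis (x * \<eta>) * m \<eta> * (cis (x * (\<xi> - \<eta>)) * m (\<xi> - \<eta>)) = cis (x * \<xi>) * (m \<eta> * m (\<xi> - \<eta>))"
        by (simp add: mult_ac)
    qed
    finally show "cis (x * \<eta>) * m \<eta> * synth m x = (LBINT \<xi>. cis (x * \<xi>) * (m \<eta> * m (\<xi> - \<eta>)))" .
  qed
  also have "\<dots> = (LBINT \<xi>. LBINT \<eta>. cis (x * \<xi>) * (m \<eta> * m (\<xi> - \<eta>)))"
  proof (rule lborel_integral_swap[OF _ integrable_norm[OF tame_integrable[OF m]] integrable_box[of B "2 * R"]])
    show "norm (cis (x * \<xi>) * (m \<eta> * m (\<xi> - \<eta>))) \<le> norm (m \<eta>) * (B * indicator {-(2*R)..2*R} \<xi>)" for \<eta> \<xi>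
    proof (cases "\<eta> \<in> {-R..R} \<and> \<xi> - \<eta> \<in> {-R..R}")
      case True
      then have "\<xi> \<in> {-(2*R)..2*R}" by auto
      then show ?thesis using B(2)[of "\<xi> - \<eta>"] True by (auto simp: norm_mult intro!: mult_left_mono)
    next
      case False
      then have "m \<eta> = 0 \<or> m (\<xi> - \<eta>) = 0" using m0 by blast
      then show ?thesis using B(1) by auto
    qed
  qed measurable
  also have "\<dots> = synth (autoconv m) x"
    unfolding synth_def autoconv_def by simp
  finally show ?thesis .
qed

text \<open>The second-order Taylor remainder of \<open>iexp\<close> is integrable against \<open>m\<close> because \<open>m\<close> has compact
support, so the difference quotient converges at a linear rate.\<close>
lemma synth_has_vector_derivative:
  assumes m: "tame m"
  shows "(synth m has_vector_derivative synth (\<lambda>\<xi>. \<i> * complex_of_real \<xi> * m \<xi>) x) (at x)"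
proof -
  let ?D = "\<lambda>\<xi>. \<i> * complex_of_real \<xi> * m \<xi>"
  note mi = tame_integrable[OF m]
  have D: "integrable lborel ?D"
    by (intro tame_integrable tame_mult_continuous[OF m] continuous_intros)
  have D2: "integrable lborel (\<lambda>\<xi>. norm (complex_of_real (\<xi>\<^sup>2) * m \<xi>))"
    by (intro integrable_norm tame_integrable tame_mult_continuous[OF m] continuous_intros)
  let ?C = "LBINT \<xi>. norm (complex_of_real (\<xi>\<^sup>2) * m \<xi>)"
  have est: "norm (synth m (x + h) - synth m x - h *\<^sub>R synth ?D x) \<le> h\<^sup>2 * ?C" for h
  proof -
    note i1 = integrable_cis_mult[OF mi, of "\<lambda>\<xi>. (x + h) * \<xi>", simplified]
    note i2 = integrable_cis_mult[OF mi, of "\<lambda>\<xi>. x * \<xi>", simplified]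
    note i3 = integrable_scaleR_right[of h, OF integrable_cis_mult[OF D, of "\<lambda>\<xi>. x * \<xi>", simplified]]
    let ?g = "\<lambda>\<xi>. cis ((x + h) * \<xi>) * m \<xi> - cis (x * \<xi>) * m \<xi> - h *\<^sub>R (cis (x * \<xi>) * ?D \<xi>)"
    have int: "integrable lborel ?g"
      using i1 i2 i3 by (intro Bochner_Integration.integrable_diff) auto
    have "synth m (x + h) - synth m x - h *\<^sub>R synth ?D x = integral\<^sup>L lborel ?g"
      unfolding synth_def using i1 i2 i3 by simp
    also have "norm \<dots> \<le> (LBINT \<xi>. h\<^sup>2 * norm (complex_of_real (\<xi>\<^sup>2) * m \<xi>))"
    proof (rule order_trans[OF integral_norm_bound integral_mono[OF integrable_norm[OF int] integrable_mult_right[OF D2]]])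
      fix \<xi> :: real
      have "?g \<xi> = cis (x * \<xi>) * (iexp (h * \<xi>) - (\<Sum>k\<le>1. (\<i> * complex_of_real (h * \<xi>)) ^ k / fact k)) * m \<xi>"
        by (simp add: cis_conv_exp distrib_right exp_add algebra_simps scaleR_conv_of_real)
      then have "norm (?g \<xi>) = norm (iexp (h * \<xi>) - (\<Sum>k\<le>1. (\<i> * complex_of_real (h * \<xi>)) ^ k / fact k)) * norm (m \<xi>)"
        by (simp only: norm_mult norm_cis mult_1)
      also have "\<dots> \<le> (\<bar>h * \<xi>\<bar> ^ Suc 1 / fact (Suc 1)) * norm (m \<xi>)"
        by (intro mult_right_mono iexp_approx1) auto
      also have "\<dots> \<le> \<bar>h * \<xi>\<bar> ^ 2 * norm (m \<xi>)"
      proof (intro mult_right_mono)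
        have "y ^ Suc 1 / fact (Suc 1) \<le> y\<^sup>2" for y :: real by (simp add: power2_eq_square)
        then show "\<bar>h * \<xi>\<bar> ^ Suc 1 / fact (Suc 1) \<le> \<bar>h * \<xi>\<bar>\<^sup>2" .
      qed simp
      also have "\<dots> = h\<^sup>2 * norm (complex_of_real (\<xi>\<^sup>2) * m \<xi>)"
        by (simp add: norm_mult power_mult_distrib norm_power)
      finally show "norm (?g \<xi>) \<le> h\<^sup>2 * norm (complex_of_real (\<xi>\<^sup>2) * m \<xi>)" .
    qed
    also have "\<dots> = h\<^sup>2 * ?C" by simp
    finally show ?thesis .
  qed
  show ?thesis
    unfolding has_vector_derivative_def has_derivative_at
  proof (intro conjI bounded_linear_scaleR_left)
    show "(\<lambda>h. norm (synth m (x + h) - synth m x - h *\<^sub>R synth ?D x) / norm h) \<midarrow>0\<rightarrow> 0"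
    proof (rule Lim_null_comparison)
      show "\<forall>\<^sub>F h in at 0. norm (norm (synth m (x + h) - synth m x - h *\<^sub>R synth ?D x) / norm h) \<le> \<bar>h\<bar> * ?C"
        unfolding eventually_at_filter
      proof (intro always_eventually allI impI)
        fix h :: real assume "h \<noteq> 0"
        moreover have "h\<^sup>2 * ?C = \<bar>h\<bar> * ?C * \<bar>h\<bar>" by (simp add: power2_eq_square)
        ultimately show "norm (norm (synth m (x + h) - synth m x - h *\<^sub>R synth ?D x) / norm h) \<le> \<bar>h\<bar> * ?C"
          using est[of h] by (simp only: real_norm_def abs_divide abs_norm_cancel abs_abs) (simp only: divide_le_eq zero_less_abs_iff if_True simp_thms)
      qed
      show "(\<lambda>h. \<bar>h\<bar> * ?C) \<midarrow>0\<rightarrow> 0" by (auto intro!: tendsto_eq_intros)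
    qed
  qed
qed

lemma nonlin_synth:
  assumes "tame m"
  shows "nonlin (synth m) = synth (\<lambda>\<xi>. \<i> * complex_of_real \<xi> * autoconv m \<xi>)"
  unfolding nonlin_def synth_square[OF assms]
  by (intro ext vector_derivative_at synth_has_vector_derivative tame_autoconv assms)

lemma phi_measurable [measurable]: "phi \<gamma> \<in> borel_measurable borel"
  unfolding phi_def[abs_def] by measurable

lemma phi_isCont: "\<xi> \<noteq> 0 \<Longrightarrow> isCont (phi \<gamma>) \<xi>"
  unfolding phi_def[abs_def] by (intro continuous_intros)

text \<open>The linear flow on the Fourier side; \<open>exp_L \<gamma> \<tau>\<close> corresponds to \<open>evol \<gamma> (- \<tau>)\<close>.\<close>
definition evol :: "real \<Rightarrow> real \<Rightarrow> (real \<Rightarrow> complex) \<Rightarrow> real \<Rightarrow> complex" where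
  "evol \<gamma> \<tau> m \<xi> = cis (phi \<gamma> \<xi> * \<tau>) * m \<xi>"

lemma norm_evol [simp]: "norm (evol \<gamma> \<tau> m \<xi>) = norm (m \<xi>)"
  by (simp add: evol_def norm_mult)

lemma tame_evol:
  assumes "tame m" shows "tame (evol \<gamma> \<tau> m)"
  unfolding evol_def[abs_def]
proof (rule tame_mult[OF assms])
  show "AE x in lborel. isCont (\<lambda>\<xi>. cis (phi \<gamma> \<xi> * \<tau>)) x"
    by (rule countable_AE_isCont[of "{0}"]) (auto intro!: continuous_intros phi_isCont)
  show "\<exists>K. \<forall>x\<in>{-R..R}. norm (cis (phi \<gamma> x * \<tau>)) \<le> K" for R
    by (intro exI[of _ 1]) simp
qed measurable

lemma exp_L_synth:
  assumes m: "tame m"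
  shows "exp_L \<gamma> \<tau> (synth m) = synth (evol \<gamma> (- \<tau>) m)"
proof -
  note [measurable] = tame_measurable[OF m] fourier_synth(2)[OF m] tame_measurable[OF tame_evol[OF m]]
  let ?F = "\<lambda>\<xi>. cis (- (phi \<gamma> \<xi> * \<tau>)) * fourier (synth m) \<xi>"
  have AE: "AE \<xi> in lborel. ?F \<xi> = evol \<gamma> (- \<tau>) m \<xi>"
    using fourier_synth(1)[OF m] by eventually_elim (simp add: evol_def)
  have "integrable lborel ?F"
    by (subst integrable_cong_AE[OF _ _ AE]) (auto intro: tame_integrable tame_evol m)
  then have "exp_L \<gamma> \<tau> (synth m) = synth ?F"
    unfolding exp_L_def by (rule inv_fourier_eq_synth)
  also have "\<dots> = synth (evol \<gamma> (- \<tau>) m)" by (rule synth_cong_AE[OF AE]) measurable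
  finally show ?thesis .
qed

text \<open>The Fourier symbol of the integrand of the Picard iterate at time \<open>\<tau>\<close>, when the datum has
transform \<open>G\<close>.\<close>
definition duhamel_integrand :: "real \<Rightarrow> (real \<Rightarrow> complex) \<Rightarrow> real \<Rightarrow> real \<Rightarrow> complex" where
  "duhamel_integrand \<gamma> G \<tau> = evol \<gamma> (- \<tau>) (\<lambda>\<xi>. \<i> * complex_of_real \<xi> * autoconv (evol \<gamma> \<tau> G) \<xi>)"

lemma tame_times_freq: "tame m \<Longrightarrow> tame (\<lambda>\<xi>. \<i> * complex_of_real \<xi> * m \<xi>)"
  by (intro tame_mult_continuous continuous_intros)

lemma exp_L_nonlin_synth:
  assumes G: "tame G"
  shows "exp_L \<gamma> \<tau> (nonlin (exp_L \<gamma> (- \<tau>) (synth G))) = synth (duhamel_integrand \<gamma> G \<tau>)"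
  unfolding exp_L_synth[OF G] nonlin_synth[OF tame_evol[OF G]] duhamel_integrand_def
  by (subst exp_L_synth) (auto intro!: tame_times_freq tame_autoconv tame_evol G)

lemma duhamel_integrand_measurable:
  assumes [measurable]: "G \<in> borel_measurable borel"
  shows "case_prod (duhamel_integrand \<gamma> G) \<in> borel_measurable (lborel \<Otimes>\<^sub>M lborel)"
proof -
  have [measurable]: "(\<lambda>p. LBINT \<eta>. evol \<gamma> (fst p) G \<eta> * evol \<gamma> (fst p) G (snd p - \<eta>)) \<in> borel_measurable (lborel \<Otimes>\<^sub>M lborel)"
    unfolding evol_def by (rule lborel.borel_measurable_lebesgue_integral) measurable
  show ?thesis
    unfolding split_beta' duhamel_integrand_def autoconv_def evol_def[of \<gamma> "- \<tau>" for \<tau>]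
    by measurable
qed

lemma duhamel_integrand_bound:
  assumes G: "tame G"
  obtains C R where "\<And>\<tau> \<xi>. norm (duhamel_integrand \<gamma> G \<tau> \<xi>) \<le> C * indicator {-R..R} \<xi>"
proof -
  obtain B R where B: "0 \<le> B" "0 \<le> R" "\<And>x. norm (G x) \<le> B * indicator {-R..R} x"
    using tame_bound[OF G] by metis
  let ?K = "LBINT \<eta>. B * B * indicator {-R..R::real} \<eta>"
  have "norm (duhamel_integrand \<gamma> G \<tau> \<xi>) \<le> (2 * R * ?K) * indicator {-(2*R)..2*R} \<xi>" for \<tau> \<xi>
  proof -
    have "norm (autoconv (evol \<gamma> \<tau> G) \<xi>) \<le> ?K * indicator {-(2*R)..2*R} \<xi>"
      by (rule autoconv_bound(2)) (use B tame_measurable[OF tame_evol[OF G]] in auto)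
    then have "\<bar>\<xi>\<bar> * norm (autoconv (evol \<gamma> \<tau> G) \<xi>) \<le> \<bar>\<xi>\<bar> * (?K * indicator {-(2*R)..2*R} \<xi>)"
      by (intro mult_left_mono) auto
    also have "\<dots> \<le> 2 * R * (?K * indicator {-(2*R)..2*R} \<xi>)"
    proof (cases "\<xi> \<in> {-(2*R)..2*R}")
      case True
      then show ?thesis using B(1) by (intro mult_right_mono) auto
    qed simp
    finally show ?thesis by (simp add: duhamel_integrand_def norm_mult mult_ac)
  qed
  then show ?thesis by (rule that)
qed

definition duhamel :: "real \<Rightarrow> real \<Rightarrow> (real \<Rightarrow> complex) \<Rightarrow> real \<Rightarrow> complex" where
  "duhamel \<gamma> t G \<xi> = (LBINT \<tau>:{0..t}. duhamel_integrand \<gamma> G \<tau> \<xi>)"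

text \<open>Only the frequency 0, where \<open>phi \<gamma>\<close> is singular, has to be excluded from the continuity
argument.\<close>
lemma tame_duhamel:
  assumes G: "tame G" shows "tame (duhamel \<gamma> t G)"
  unfolding tame_def
proof (intro conjI)
  note [measurable] = duhamel_integrand_measurable[OF tame_measurable[OF G]]
  obtain C R where C: "\<And>\<tau> \<xi>. norm (duhamel_integrand \<gamma> G \<tau> \<xi>) \<le> C * indicator {-R..R} \<xi>"
    using duhamel_integrand_bound[OF G] by metis
  have C': "norm (duhamel_integrand \<gamma> G \<tau> \<xi>) \<le> \<bar>C\<bar>" for \<tau> \<xi>
    by (rule order_trans[OF C]) (auto simp: indicator_def)
  have ind: "integrable lborel (\<lambda>\<tau>. \<bar>C\<bar> * indicator {0..t} \<tau>)"
    by (intro integrable_mult_right integrable_real_indicator) (auto simp: emeasure_lborel_Icc_eq)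
  have [measurable]: "(\<lambda>\<tau>. duhamel_integrand \<gamma> G \<tau> \<xi>) \<in> borel_measurable lborel" for \<xi>
    by measurable
  have ddef: "duhamel \<gamma> t G = (\<lambda>\<xi>. LBINT \<tau>. indicator {0..t} \<tau> *\<^sub>R duhamel_integrand \<gamma> G \<tau> \<xi>)"
    by (simp add: duhamel_def[abs_def] set_lebesgue_integral_def)
  have "(\<lambda>\<xi>. LBINT \<tau>. indicator {0..t} \<tau> *\<^sub>R duhamel_integrand \<gamma> G \<tau> \<xi>) \<in> borel_measurable lborel"
    by (rule lborel.borel_measurable_lebesgue_integral) measurable
  then show "duhamel \<gamma> t G \<in> borel_measurable borel" unfolding ddef by simp
  have le: "norm (indicator {0..t} \<tau> *\<^sub>R duhamel_integrand \<gamma> G \<tau> \<xi>) \<le> \<bar>C\<bar> * indicator {0..t} \<tau>" for \<tau> \<xi>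
    using C' by (auto simp: indicator_def)
  have int: "integrable lborel (\<lambda>\<tau>. indicator {0..t} \<tau> *\<^sub>R duhamel_integrand \<gamma> G \<tau> \<xi>)" for \<xi>
    by (rule Bochner_Integration.integrable_bound[OF ind]) (use le[of _ \<xi>] in \<open>auto simp: abs_mult\<close>)
  show "AE x in lborel. isCont (duhamel \<gamma> t G) x"
  proof (rule countable_AE_isCont[of "{0}"])
    fix \<xi> :: real assume "\<xi> \<notin> {0}"
    then have \<xi>: "\<xi> \<noteq> 0" by simp
    have cont: "isCont (duhamel_integrand \<gamma> G \<tau>) \<xi>" for \<tau>
      unfolding duhamel_integrand_def evol_def[of \<gamma> "- \<tau>", abs_def]
      by (intro continuous_intros phi_isCont \<xi> autoconv_isCont tame_evol G)
    have "(duhamel \<gamma> t G \<longlongrightarrow> duhamel \<gamma> t G \<xi>) (at \<xi>)"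
      unfolding tendsto_at_iff_sequentially ddef comp_def
    proof (intro allI impI)
      fix X assume "\<forall>i. X i \<in> UNIV - {\<xi>}" and X: "X \<longlonglongrightarrow> \<xi>"
      show "(\<lambda>n. LBINT \<tau>. indicator {0..t} \<tau> *\<^sub>R duhamel_integrand \<gamma> G \<tau> (X n))
         \<longlonglongrightarrow> (LBINT \<tau>. indicator {0..t} \<tau> *\<^sub>R duhamel_integrand \<gamma> G \<tau> \<xi>)"
      proof (rule integral_dominated_convergence[OF _ _ ind])
        show "AE \<tau> in lborel. (\<lambda>n. indicator {0..t} \<tau> *\<^sub>R duhamel_integrand \<gamma> G \<tau> (X n))
           \<longlonglongrightarrow> indicator {0..t} \<tau> *\<^sub>R duhamel_integrand \<gamma> G \<tau> \<xi>"
          by (intro AE_I2 tendsto_intros isCont_tendsto_compose[OF cont] X)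
      qed (use le in auto)
    qed
    then show "isCont (duhamel \<gamma> t G) \<xi>" by (simp add: isCont_def)
  qed simp
  have "norm (duhamel \<gamma> t G \<xi>) \<le> (LBINT \<tau>. \<bar>C\<bar> * indicator {0..t} \<tau>) * indicator {-R..R} \<xi>" for \<xi>
  proof (cases "\<xi> \<in> {-R..R}")
    case True
    have "norm (duhamel \<gamma> t G \<xi>) \<le> (LBINT \<tau>. \<bar>C\<bar> * indicator {0..t} \<tau>)"
      unfolding ddef by (rule order_trans[OF integral_norm_bound integral_mono[OF integrable_norm[OF int] ind le]])
    then show ?thesis using True by (simp only: indicator_simps mult_1_right)
  next
    case False
    then have "duhamel_integrand \<gamma> G \<tau> \<xi> = 0" for \<tau> using C[of \<tau> \<xi>] by simp
    then show ?thesis using False by (simp add: ddef)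
  qed
  then show "\<exists>B R. \<forall>x. norm (duhamel \<gamma> t G x) \<le> B * indicator {-R..R} x" by blast
qed

lemma integral_synth_duhamel:
  assumes G: "tame G"
  shows "(LBINT \<tau>:{0..t}. synth (duhamel_integrand \<gamma> G \<tau>) y) = synth (duhamel \<gamma> t G) y"
proof -
  note [measurable] = duhamel_integrand_measurable[OF tame_measurable[OF G]]
  obtain C R where C: "\<And>\<tau> \<xi>. norm (duhamel_integrand \<gamma> G \<tau> \<xi>) \<le> C * indicator {-R..R} \<xi>"
    using duhamel_integrand_bound[OF G] by metis
  have ind: "integrable lborel (indicator {0..t} :: real \<Rightarrow> real)"
    by (intro integrable_real_indicator) (auto simp: emeasure_lborel_Icc_eq)
  have "(LBINT \<tau>:{0..t}. synth (duhamel_integrand \<gamma> G \<tau>) y) =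
     (LBINT \<tau>. LBINT \<xi>. indicator {0..t} \<tau> *\<^sub>R (cis (y * \<xi>) * duhamel_integrand \<gamma> G \<tau> \<xi>))"
    unfolding set_lebesgue_integral_def synth_def by simp
  also have "\<dots> = (LBINT \<xi>. LBINT \<tau>. indicator {0..t} \<tau> *\<^sub>R (cis (y * \<xi>) * duhamel_integrand \<gamma> G \<tau> \<xi>))"
  proof (rule lborel_integral_swap[OF _ ind integrable_box[of C R]])
    show "norm (indicator {0..t} \<tau> *\<^sub>R (cis (y * \<xi>) * duhamel_integrand \<gamma> G \<tau> \<xi>))
        \<le> indicator {0..t} \<tau> * (C * indicator {-R..R} \<xi>)" for \<tau> \<xi>
      using C[of \<tau> \<xi>] by (auto simp: norm_mult intro!: mult_left_mono)
  qed measurable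
  also have "\<dots> = synth (duhamel \<gamma> t G) y"
    unfolding synth_def duhamel_def set_lebesgue_integral_def
    by (intro Bochner_Integration.integral_cong refl) (simp flip: mult_scaleR_right)
  finally show ?thesis .
qed

lemma picard_nonlinear_synth:
  assumes G: "tame G"
  shows "picard_nonlinear \<gamma> t (synth G) = synth (\<lambda>\<xi>. - evol \<gamma> t (duhamel \<gamma> t G) \<xi>)"
proof
  fix x
  show "picard_nonlinear \<gamma> t (synth G) x = synth (\<lambda>\<xi>. - evol \<gamma> t (duhamel \<gamma> t G) \<xi>) x"
    unfolding picard_nonlinear_def exp_L_nonlin_synth[OF G] integral_synth_duhamel[OF G]
    by (simp only: exp_L_synth[OF tame_duhamel[OF G]] minus_minus) (simp add: synth_def)
qed

lemma tame_uminus: "tame m \<Longrightarrow> tame (\<lambda>\<xi>. - m \<xi>)"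
  using tame_mult_continuous[of m "\<lambda>_. -1"] by simp

lemma sobolev_norm_picard:
  assumes G: "tame G"
  shows "sobolev_norm s (picard_nonlinear \<gamma> t (synth G)) =
     (let I = \<integral>\<^sup>+ \<xi>. ennreal ((1 + \<xi>\<^sup>2) powr s * (norm (duhamel \<gamma> t G \<xi>))\<^sup>2) \<partial>lborel
      in if I = \<infinity> then \<infinity> else ennreal (sqrt (enn2real I)))"
  unfolding picard_nonlinear_synth[OF G]
  by (subst sobolev_norm_synth) (auto intro!: tame_uminus tame_evol tame_duhamel G)

text \<open>If every interacting pair of frequencies has a resonance function of size at most \<open>1 / t\<close>, the
phases \<open>cis (- (\<Omega> * \<tau>))\<close> in the Duhamel integral have real part at least \<open>1 / 2\<close>. As \<open>g\<close> is
non-negative, there is no cancellation and the symbol is at least half of what it would be without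
oscillation.\<close>
lemma norm_duhamel_ge:
  fixes g :: "real \<Rightarrow> real"
  assumes G: "tame (\<lambda>\<xi>. complex_of_real (g \<xi>))" and g: "\<And>\<xi>. 0 \<le> g \<xi>" and t: "t \<ge> 0"
    and res: "\<And>\<eta>. g \<eta> * g (\<xi> - \<eta>) \<noteq> 0 \<Longrightarrow> \<bar>phi \<gamma> \<xi> - phi \<gamma> \<eta> - phi \<gamma> (\<xi> - \<eta>)\<bar> * t \<le> 1"
  shows "\<bar>\<xi>\<bar> * (t / 2 * (LBINT \<eta>. g \<eta> * g (\<xi> - \<eta>))) \<le> norm (duhamel \<gamma> t (\<lambda>\<xi>. complex_of_real (g \<xi>)) \<xi>)"
proof -
  let ?G = "\<lambda>\<xi>. complex_of_real (g \<xi>)"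
  note [measurable] = duhamel_integrand_measurable[OF tame_measurable[OF G]]
  obtain B R where B: "0 \<le> B" "\<And>x. norm (?G x) \<le> B * indicator {-R..R} x"
    using tame_bound[OF G] by metis
  let ?q = "LBINT \<eta>. g \<eta> * g (\<xi> - \<eta>)"
  let ?\<Omega> = "\<lambda>\<eta>. phi \<gamma> \<xi> - phi \<gamma> \<eta> - phi \<gamma> (\<xi> - \<eta>)"
  let ?k = "\<lambda>\<tau>. cis (phi \<gamma> \<xi> * - \<tau>) * autoconv (evol \<gamma> \<tau> ?G) \<xi>"
  have qi: "integrable lborel (\<lambda>\<eta>. g \<eta> * g (\<xi> - \<eta>))"
  proof -
    have "integrable lborel (\<lambda>\<eta>. ?G \<eta> * ?G (\<xi> - \<eta>))"
      by (rule autoconv_bound(1)[OF B(2) B(1) tame_measurable[OF G]])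
    then have "integrable lborel (\<lambda>\<eta>. Re (?G \<eta> * ?G (\<xi> - \<eta>)))" by (rule integrable_Re)
    then show ?thesis by simp
  qed
  have k_ge: "?q / 2 \<le> Re (?k \<tau>)" if \<tau>: "\<tau> \<in> {0..t}" for \<tau>
  proof -
    have int: "integrable lborel (\<lambda>\<eta>. evol \<gamma> \<tau> ?G \<eta> * evol \<gamma> \<tau> ?G (\<xi> - \<eta>))"
      by (rule autoconv_bound(1)[OF _ B(1)]) (use B(2) tame_measurable[OF tame_evol[OF G]] in auto)
    have int': "integrable lborel (\<lambda>\<eta>. cis (phi \<gamma> \<xi> * - \<tau>) * (evol \<gamma> \<tau> ?G \<eta> * evol \<gamma> \<tau> ?G (\<xi> - \<eta>)))"
      by (rule integrable_mult_right[OF int])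
    have eq: "Re (cis (phi \<gamma> \<xi> * - \<tau>) * (evol \<gamma> \<tau> ?G \<eta> * evol \<gamma> \<tau> ?G (\<xi> - \<eta>))) = cos (?\<Omega> \<eta> * \<tau>) * (g \<eta> * g (\<xi> - \<eta>))" for \<eta>
    proof -
      have "cis (phi \<gamma> \<xi> * - \<tau>) * (evol \<gamma> \<tau> ?G \<eta> * evol \<gamma> \<tau> ?G (\<xi> - \<eta>))
         = (cis (phi \<gamma> \<xi> * - \<tau>) * cis (phi \<gamma> \<eta> * \<tau>) * cis (phi \<gamma> (\<xi> - \<eta>) * \<tau>)) * complex_of_real (g \<eta> * g (\<xi> - \<eta>))"
        by (simp add: evol_def mult_ac)
      also have "cis (phi \<gamma> \<xi> * - \<tau>) * cis (phi \<gamma> \<eta> * \<tau>) * cis (phi \<gamma> (\<xi> - \<eta>) * \<tau>) = cis (- (?\<Omega> \<eta> * \<tau>))"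
        by (simp add: cis_mult algebra_simps)
      finally show ?thesis by simp
    qed
    have "Re (?k \<tau>) = (LBINT \<eta>. Re (cis (phi \<gamma> \<xi> * - \<tau>) * (evol \<gamma> \<tau> ?G \<eta> * evol \<gamma> \<tau> ?G (\<xi> - \<eta>))))"
      unfolding integral_Re[OF int'] autoconv_def by (simp only: integral_mult_right_zero)
    then have k: "Re (?k \<tau>) = (LBINT \<eta>. cos (?\<Omega> \<eta> * \<tau>) * (g \<eta> * g (\<xi> - \<eta>)))"
      unfolding eq .
    have "(LBINT \<eta>. 1 / 2 * (g \<eta> * g (\<xi> - \<eta>))) \<le> (LBINT \<eta>. cos (?\<Omega> \<eta> * \<tau>) * (g \<eta> * g (\<xi> - \<eta>)))"
    proof (rule integral_mono)
      show "integrable lborel (\<lambda>\<eta>. 1 / 2 * (g \<eta> * g (\<xi> - \<eta>)))" using qi by (rule integrable_mult_right)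
      show "integrable lborel (\<lambda>\<eta>. cos (?\<Omega> \<eta> * \<tau>) * (g \<eta> * g (\<xi> - \<eta>)))"
        using integrable_Re[OF int'] unfolding eq .
      fix \<eta>
      show "1 / 2 * (g \<eta> * g (\<xi> - \<eta>)) \<le> cos (?\<Omega> \<eta> * \<tau>) * (g \<eta> * g (\<xi> - \<eta>))"
      proof (cases "g \<eta> * g (\<xi> - \<eta>) = 0")
        case False
        have "\<bar>?\<Omega> \<eta>\<bar> * \<tau> \<le> \<bar>?\<Omega> \<eta>\<bar> * t" using \<tau> by (intro mult_left_mono) auto
        then have "\<bar>?\<Omega> \<eta> * \<tau>\<bar> \<le> 1" using res[OF False] \<tau> by (simp add: abs_mult)
        then have "\<bar>?\<Omega> \<eta> * \<tau>\<bar> \<le> pi / 3" using pi_gt3 by linarith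
        then have "cos (pi / 3) \<le> cos \<bar>?\<Omega> \<eta> * \<tau>\<bar>" by (intro cos_monotone_0_pi_le) auto
        then have "1 / 2 \<le> cos (?\<Omega> \<eta> * \<tau>)" unfolding cos_abs_real cos_60 .
        then show ?thesis using g by (intro mult_right_mono) auto
      qed auto
    qed
    then show ?thesis unfolding k by simp
  qed
  have split: "duhamel_integrand \<gamma> ?G \<tau> \<xi> = \<i> * complex_of_real \<xi> * ?k \<tau>" for \<tau>
    by (simp add: duhamel_integrand_def evol_def[of \<gamma> "-\<tau>"])
  show ?thesis
  proof (cases "\<xi> = 0")
    case False
    have [measurable]: "(\<lambda>\<tau>. duhamel_integrand \<gamma> ?G \<tau> \<xi>) \<in> borel_measurable lborel" by measurable
    obtain C R where C: "\<And>\<tau> \<xi>. norm (duhamel_integrand \<gamma> ?G \<tau> \<xi>) \<le> C * indicator {-R..R} \<xi>"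
      using duhamel_integrand_bound[OF G] by metis
    let ?C = "C * indicator {-R..R} \<xi>"
    have ind: "integrable lborel (\<lambda>\<tau>. c * indicator {0..t} \<tau> :: real)" for c
      by (intro integrable_mult_right integrable_real_indicator) (auto simp: emeasure_lborel_Icc_eq)
    have "integrable lborel (\<lambda>\<tau>. indicator {0..t} \<tau> *\<^sub>R duhamel_integrand \<gamma> ?G \<tau> \<xi>)"
      by (rule Bochner_Integration.integrable_bound[OF ind[of ?C]])
         (use C[of _ \<xi>] in \<open>auto intro!: AE_I2 simp: abs_mult indicator_def intro: order_trans[OF _ abs_ge_self]\<close>)
    then have "integrable lborel (\<lambda>\<tau>. (1 / (\<i> * complex_of_real \<xi>)) * (indicator {0..t} \<tau> *\<^sub>R duhamel_integrand \<gamma> ?G \<tau> \<xi>))"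
      by (rule integrable_mult_right)
    then have ki: "integrable lborel (\<lambda>\<tau>. indicator {0..t} \<tau> *\<^sub>R ?k \<tau>)"
      using False by (simp add: split)
    have "duhamel \<gamma> t ?G \<xi> = (LBINT \<tau>. \<i> * complex_of_real \<xi> * (indicator {0..t} \<tau> *\<^sub>R ?k \<tau>))"
      unfolding duhamel_def set_lebesgue_integral_def split by simp
    also have "\<dots> = \<i> * complex_of_real \<xi> * (LBINT \<tau>. indicator {0..t} \<tau> *\<^sub>R ?k \<tau>)"
      by (rule integral_mult_right_zero)
    finally have "norm (duhamel \<gamma> t ?G \<xi>) = \<bar>\<xi>\<bar> * norm (LBINT \<tau>. indicator {0..t} \<tau> *\<^sub>R ?k \<tau>)"
      by (simp add: norm_mult)
    moreover have "t / 2 * ?q \<le> norm (LBINT \<tau>. indicator {0..t} \<tau> *\<^sub>R ?k \<tau>)"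
    proof -
      have "t / 2 * ?q = (LBINT \<tau>. ?q / 2 * indicator {0..t} \<tau>)" using t by simp
      also have "\<dots> \<le> (LBINT \<tau>. Re (indicator {0..t} \<tau> *\<^sub>R ?k \<tau>))"
      proof (rule integral_mono[OF ind integrable_Re[OF ki]])
        fix \<tau> show "?q / 2 * indicator {0..t} \<tau> \<le> Re (indicator {0..t} \<tau> *\<^sub>R ?k \<tau>)"
          using k_ge[of \<tau>] by (cases "\<tau> \<in> {0..t}") (simp_all only: indicator_simps scaleR_one mult_1_right mult_zero_right scaleR_zero_left complex.sel zero_complex.sel order_refl simp_thms)
      qed
      also have "\<dots> = Re (LBINT \<tau>. indicator {0..t} \<tau> *\<^sub>R ?k \<tau>)" by (rule integral_Re[OF ki])
      also have "\<dots> \<le> norm (LBINT \<tau>. indicator {0..t} \<tau> *\<^sub>R ?k \<tau>)" by (rule complex_Re_le_cmod)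
      finally show ?thesis .
    qed
    ultimately show ?thesis by (simp only: mult_left_mono abs_ge_zero)
  qed simp
qed

section \<open>Resonant data and the lower bound\<close>

text \<open>The non-negative frequency \<open>\<zeta>\<close> at which \<open>3 * N\<^sup>2 * \<zeta> + \<gamma> / \<zeta>\<close> vanishes: to leading order, the resonance
function of \<open>N\<close> and \<open>\<zeta>\<close>.\<close>
definition low_freq :: "real \<Rightarrow> real \<Rightarrow> real" where
  "low_freq \<gamma> N = sqrt (- \<gamma> / 3) / N"

text \<open>The two intervals of length \<open>\<delta>\<close> on the positive half-line, near the high frequency \<open>N\<close> and near the
resonant low frequency, and their mirror images, which make the datum real. The low interval starts
\<open>2 * \<delta>\<close> above the resonant frequency so that, even when \<open>\<gamma> = 0\<close> and \<open>low_freq \<gamma> N = 0\<close>, the sums of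
the two positive intervals do not meet the sums of the high interval and the mirrored low one.\<close>
definition profile_support :: "real \<Rightarrow> real \<Rightarrow> real \<Rightarrow> real set" where
  "profile_support \<gamma> N \<delta> =
     {N..N + \<delta>} \<union> {low_freq \<gamma> N + 2 * \<delta>..low_freq \<gamma> N + 3 * \<delta>} \<union>
     ({- (N + \<delta>)..- N} \<union> {- (low_freq \<gamma> N + 3 * \<delta>)..- (low_freq \<gamma> N + 2 * \<delta>)})"

text \<open>The weight makes \<open>(1 + \<xi>\<^sup>2) powr s * (profile \<gamma> s N \<delta> \<xi>)\<^sup>2\<close> equal to \<open>1 / \<delta>\<close> on the support, so
that the Sobolev norm of order \<open>s\<close> is just the measure of the support over \<open>\<delta>\<close>, up to a root.\<close>
definition profile :: "real \<Rightarrow> real \<Rightarrow> real \<Rightarrow> real \<Rightarrow> real \<Rightarrow> real" where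
  "profile \<gamma> s N \<delta> \<xi> = (1 + \<xi>\<^sup>2) powr (- s / 2) / sqrt \<delta> * indicator (profile_support \<gamma> N \<delta>) \<xi>"

lemma profile_nonneg: "0 \<le> \<delta> \<Longrightarrow> 0 \<le> profile \<gamma> s N \<delta> \<xi>"
  by (simp add: profile_def)

lemma profile_even: "profile \<gamma> s N \<delta> (- \<xi>) = profile \<gamma> s N \<delta> \<xi>"
proof -
  have "- \<xi> \<in> profile_support \<gamma> N \<delta> \<longleftrightarrow> \<xi> \<in> profile_support \<gamma> N \<delta>"
    unfolding profile_support_def by (simp only: Un_iff atLeastAtMost_iff) linarith
  then show ?thesis by (simp add: profile_def indicator_def)
qed

lemma tame_profile: "tame (\<lambda>\<xi>. complex_of_real (profile \<gamma> s N \<delta> \<xi>))"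
proof -
  let ?S = "profile_support \<gamma> N \<delta>"
  have fr: "finite (frontier (A \<union> B))" if "finite (frontier A)" "finite (frontier B)" for A B :: "real set"
    using finite_subset[OF frontier_Un_subset, of A B] that by blast
  have "tame (\<lambda>\<xi>. complex_of_real ((1 + \<xi>\<^sup>2) powr (- s / 2) / sqrt \<delta>) * indicator ?S \<xi>)"
  proof (rule tame_mult_continuous)
    show "tame (indicator ?S)"
    proof (rule tame_indicator)
      show "?S \<in> sets borel" unfolding profile_support_def by measurable
      show "?S \<subseteq> {- (\<bar>N\<bar> + \<bar>\<delta>\<bar> + \<bar>low_freq \<gamma> N + 3 * \<delta>\<bar> + \<bar>low_freq \<gamma> N + 2 * \<delta>\<bar>)..
          \<bar>N\<bar> + \<bar>\<delta>\<bar> + \<bar>low_freq \<gamma> N + 3 * \<delta>\<bar> + \<bar>low_freq \<gamma> N + 2 * \<delta>\<bar>}"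
        unfolding profile_support_def by (intro subsetI) (simp only: Un_iff atLeastAtMost_iff, linarith)
      show "finite (frontier ?S)"
        unfolding profile_support_def by (intro fr finite_frontier_Icc)
    qed
    show "isCont (\<lambda>\<xi>. complex_of_real ((1 + \<xi>\<^sup>2) powr (- s / 2) / sqrt \<delta>)) x" for x
    proof (cases "\<delta> = 0")
      case False
      have "1 + x\<^sup>2 \<noteq> 0" by (smt (verit) zero_le_power2)
      then show ?thesis using False by (intro continuous_intros) auto
    qed simp
  qed
  moreover have "(\<lambda>\<xi>. complex_of_real ((1 + \<xi>\<^sup>2) powr (- s / 2) / sqrt \<delta>) * indicator ?S \<xi>) =
    (\<lambda>\<xi>. complex_of_real (profile \<gamma> s N \<delta> \<xi>))"
    by (auto simp: profile_def indicator_def)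
  ultimately show ?thesis by simp
qed

lemma synth_real_of_even:
  assumes "\<And>\<xi>. g (- \<xi>) = g \<xi>"
  shows "complex_of_real (Re (synth (\<lambda>\<xi>. complex_of_real (g \<xi>)) x)) = synth (\<lambda>\<xi>. complex_of_real (g \<xi>)) x"
proof -
  let ?G = "\<lambda>\<xi>. complex_of_real (g \<xi>)"
  have "cnj (synth ?G x) = (LBINT \<xi>. cis (- (x * \<xi>)) * ?G \<xi>)"
    unfolding synth_def Bochner_Integration.integral_cnj[symmetric] by (simp add: cis_cnj)
  also have "\<dots> = synth ?G x"
    unfolding synth_def
    using lborel_integral_real_affine[of "-1" "\<lambda>\<xi>. cis (- (x * \<xi>)) * ?G \<xi>" 0] by (simp add: assms)
  finally show ?thesis by (simp add: complex_eq_iff)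
qed

text \<open>On the two intervals the resonance function stays bounded although, for negative \<open>\<gamma>\<close>, its two
dominant terms \<open>3 * N\<^sup>2 * \<zeta>\<close> and \<open>\<gamma> / \<zeta>\<close> have size \<open>N\<close>. Writing \<open>\<kappa> = sqrt (- \<gamma> / 3)\<close>, their sum factors as
\<open>3 * (N * \<zeta> - \<kappa>) * (N * \<zeta> + \<kappa>) / \<zeta>\<close>, where the first factor is of order \<open>c / N\<close> and the quotient is
at most \<open>2 * N\<close>; the remaining terms are of order \<open>1 / N\<close>. For positive \<open>\<gamma>\<close> the two
dominant terms would have the same sign and could not cancel.\<close>
lemma resonance_bound:
  assumes \<gamma>: "\<gamma> \<le> 0" and N: "1 \<le> N" and \<delta>: "\<delta> = c / N\<^sup>2" and c: "0 < c" "c \<le> 1"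
    and L: "L = sqrt (- \<gamma> / 3) + 4"
    and \<eta>: "\<eta> \<in> {N..N + \<delta>}" and \<zeta>: "\<zeta> \<in> {low_freq \<gamma> N + 2 * \<delta>..low_freq \<gamma> N + 3 * \<delta>}"
  shows "\<bar>phi \<gamma> (\<eta> + \<zeta>) - phi \<gamma> \<eta> - phi \<gamma> \<zeta>\<bar> \<le> 18 * c + (3 * (2 * L + L\<^sup>2) * L - \<gamma> * L) / N"
proof -
  define \<kappa> where "\<kappa> = sqrt (- \<gamma> / 3)"
  have \<kappa>: "0 \<le> \<kappa>" and \<gamma>\<kappa>: "\<gamma> = - 3 * \<kappa>\<^sup>2" and L': "L = \<kappa> + 4"
    using \<gamma> L by (auto simp: \<kappa>_def)
  have lf: "low_freq \<gamma> N = \<kappa> / N" by (simp add: low_freq_def \<kappa>_def)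
  have N0: "0 < N" using N by simp
  have \<delta>0: "0 < \<delta>" using c N0 by (simp add: \<delta>)
  have \<kappa>N: "0 \<le> \<kappa> / N" using \<kappa> N0 by simp
  have "1 / N\<^sup>2 \<le> 1 / N" using N by (intro divide_left_mono) (auto simp: power2_eq_square)
  moreover have "\<delta> \<le> 1 / N\<^sup>2" unfolding \<delta> using c by (intro divide_right_mono) auto
  ultimately have "\<kappa> / N + 4 * \<delta> \<le> \<kappa> / N + 4 * (1 / N)" by simp
  also have "\<dots> = L / N" by (simp add: L' add_divide_distrib)
  finally have sumL: "\<kappa> / N + 4 * \<delta> \<le> L / N" .
  have L0: "0 \<le> L" using \<kappa> L' by simp
  have \<zeta>0: "0 < \<zeta>" using \<zeta> \<kappa>N \<delta>0 unfolding lf by simp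
  have \<zeta>L: "\<zeta> \<le> L / N" and \<delta>\<zeta>L: "\<delta> + \<zeta> \<le> L / N" using \<zeta> sumL \<delta>0 unfolding lf by auto
  define \<xi> where "\<xi> = \<eta> + \<zeta>"
  have \<eta>0: "0 < \<eta>" "N \<le> \<eta>" and \<xi>0: "0 < \<xi>" "N \<le> \<xi>" using \<eta> N0 \<zeta>0 by (auto simp: \<xi>_def)
  have LN: "L / N \<le> L" using N L0 by (simp add: divide_le_eq mult_le_cancel_left1)
  \<comment> \<open>the cubic parts combine by \<open>(\<eta> + \<zeta>) ^ 3 - \<eta> ^ 3 - \<zeta> ^ 3 = 3 * (\<eta> + \<zeta>) * \<eta> * \<zeta>\<close>\<close>
  have decomp: "phi \<gamma> \<xi> - phi \<gamma> \<eta> - phi \<gamma> \<zeta> =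
      (3 * N\<^sup>2 * \<zeta> + \<gamma> / \<zeta>) + 3 * (\<xi> * \<eta> - N\<^sup>2) * \<zeta> + \<gamma> * \<zeta> / (\<xi> * \<eta>)"
  proof -
    have "\<gamma> / \<eta> - \<gamma> / \<xi> = \<gamma> * \<zeta> / (\<xi> * \<eta>)"
      using \<eta>0 \<xi>0 by (simp add: field_simps) (simp add: \<xi>_def algebra_simps)
    moreover have "\<xi> ^ 3 - \<eta> ^ 3 - \<zeta> ^ 3 = 3 * \<xi> * \<eta> * \<zeta>"
      by (simp add: \<xi>_def power3_eq_cube algebra_simps)
    ultimately show ?thesis unfolding phi_def by (simp add: algebra_simps)
  qed
  have main: "0 \<le> 3 * N\<^sup>2 * \<zeta> + \<gamma> / \<zeta> \<and> 3 * N\<^sup>2 * \<zeta> + \<gamma> / \<zeta> \<le> 18 * c"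
  proof -
    have a: "0 \<le> N * \<zeta> - \<kappa>" "N * \<zeta> - \<kappa> \<le> 3 * c / N"
    proof -
      have "N * (\<kappa> / N + 2 * \<delta>) \<le> N * \<zeta>" "N * \<zeta> \<le> N * (\<kappa> / N + 3 * \<delta>)"
        using \<zeta> N0 unfolding lf by (auto intro!: mult_left_mono)
      moreover have "N * (\<kappa> / N + 2 * \<delta>) = \<kappa> + 2 * c / N" "N * (\<kappa> / N + 3 * \<delta>) = \<kappa> + 3 * c / N"
        using N0 by (auto simp: \<delta> field_simps power2_eq_square)
      moreover have "0 \<le> 2 * c / N" using c N0 by simp
      ultimately show "0 \<le> N * \<zeta> - \<kappa>" "N * \<zeta> - \<kappa> \<le> 3 * c / N" by linarith+
    qed
    have b: "0 \<le> (N * \<zeta> + \<kappa>) / \<zeta>" "(N * \<zeta> + \<kappa>) / \<zeta> \<le> 2 * N"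
      using a \<zeta>0 N0 \<kappa> by (auto simp: divide_le_eq)
    have eq: "3 * N\<^sup>2 * \<zeta> + \<gamma> / \<zeta> = 3 * ((N * \<zeta> - \<kappa>) * ((N * \<zeta> + \<kappa>) / \<zeta>))"
      using \<zeta>0 by (simp add: \<gamma>\<kappa> field_simps power2_eq_square)
    have "(N * \<zeta> - \<kappa>) * ((N * \<zeta> + \<kappa>) / \<zeta>) \<le> (3 * c / N) * (2 * N)"
      using a b c N0 by (intro mult_mono) auto
    also have "\<dots> = 6 * c" using N0 by simp
    finally show ?thesis unfolding eq using mult_nonneg_nonneg[OF a(1) b(1)] by linarith
  qed
  have r1: "0 \<le> 3 * (\<xi> * \<eta> - N\<^sup>2) * \<zeta> \<and> 3 * (\<xi> * \<eta> - N\<^sup>2) * \<zeta> \<le> 3 * (2 * L + L\<^sup>2) * L / N"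
  proof -
    have lo: "0 \<le> \<xi> * \<eta> - N\<^sup>2" using mult_mono[OF \<xi>0(2) \<eta>0(2)] \<xi>0 N0 by (simp add: power2_eq_square)
    have le: "\<xi> \<le> N + L / N" "\<eta> \<le> N + L / N" using \<eta> \<delta>\<zeta>L \<zeta>0 by (auto simp: \<xi>_def)
    have "\<xi> * \<eta> \<le> (N + L / N) * (N + L / N)" using le \<eta>0 \<xi>0 by (intro mult_mono) auto
    also have "\<dots> = N\<^sup>2 + 2 * L + (L / N) * (L / N)" using N0 by (simp add: field_simps power2_eq_square)
    also have "(L / N) * (L / N) \<le> L * L" using LN L0 N0 by (intro mult_mono) auto
    finally have hi: "\<xi> * \<eta> - N\<^sup>2 \<le> 2 * L + L\<^sup>2" by (simp add: power2_eq_square)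
    have "(\<xi> * \<eta> - N\<^sup>2) * \<zeta> \<le> (2 * L + L\<^sup>2) * (L / N)" using lo hi \<zeta>0 \<zeta>L L0 by (intro mult_mono) auto
    then have "3 * ((\<xi> * \<eta> - N\<^sup>2) * \<zeta>) \<le> 3 * ((2 * L + L\<^sup>2) * (L / N))" by simp
    then have "3 * (\<xi> * \<eta> - N\<^sup>2) * \<zeta> \<le> 3 * (2 * L + L\<^sup>2) * L / N"
      by (simp only: mult.assoc times_divide_eq_right)
    moreover have "0 \<le> 3 * (\<xi> * \<eta> - N\<^sup>2) * \<zeta>" using lo \<zeta>0 by simp
    ultimately show ?thesis by blast
  qed
  have r2: "0 \<le> - \<gamma> * \<zeta> / (\<xi> * \<eta>) \<and> - \<gamma> * \<zeta> / (\<xi> * \<eta>) \<le> - \<gamma> * L / N"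
  proof -
    have "1 \<le> \<xi> * \<eta>" using mult_mono[of 1 \<xi> 1 \<eta>] \<xi>0 \<eta>0 N by simp
    then have "- \<gamma> * \<zeta> / (\<xi> * \<eta>) \<le> (- \<gamma> * \<zeta>) / 1" using \<gamma> \<zeta>0 \<xi>0 \<eta>0
      by (intro divide_left_mono) (auto simp: mult_nonpos_nonneg)
    also have "(- \<gamma> * \<zeta>) / 1 \<le> - \<gamma> * (L / N)"
      unfolding div_by_1 by (rule mult_left_mono) (use \<gamma> \<zeta>L in auto)
    finally show ?thesis using \<gamma> \<zeta>0 \<xi>0 \<eta>0 by (simp add: mult_nonpos_nonneg divide_nonpos_pos)
  qed
  have "\<bar>phi \<gamma> \<xi> - phi \<gamma> \<eta> - phi \<gamma> \<zeta>\<bar> \<le> 18 * c + 3 * (2 * L + L\<^sup>2) * L / N + (- \<gamma> * L / N)"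
    unfolding decomp
  proof -
    have add_signs: "\<bar>x + y + z\<bar> \<le> u + v + w" if "0 \<le> x \<and> x \<le> u" "0 \<le> y \<and> y \<le> v" "z \<le> 0 \<and> - w \<le> z"
      for x y z u v w :: real using that by linarith
    have "\<gamma> * \<zeta> / (\<xi> * \<eta>) \<le> 0 \<and> - (- \<gamma> * L / N) \<le> \<gamma> * \<zeta> / (\<xi> * \<eta>)" using r2 by simp
    then show "\<bar>3 * N\<^sup>2 * \<zeta> + \<gamma> / \<zeta> + 3 * (\<xi> * \<eta> - N\<^sup>2) * \<zeta> + \<gamma> * \<zeta> / (\<xi> * \<eta>)\<bar>
        \<le> 18 * c + 3 * (2 * L + L\<^sup>2) * L / N + (- \<gamma> * L / N)"
      by (rule add_signs[OF main r1])
  qed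
  then show ?thesis by (simp add: \<xi>_def diff_divide_distrib add_divide_distrib)
qed

lemma sobolev_value_bounds:
  fixes I :: ennreal
  shows "ennreal (r\<^sup>2) \<le> I \<Longrightarrow> 0 \<le> r \<Longrightarrow> ennreal r \<le> (if I = \<infinity> then \<infinity> else ennreal (sqrt (enn2real I)))"
    and "I \<le> ennreal (r\<^sup>2) \<Longrightarrow> 0 \<le> r \<Longrightarrow> (if I = \<infinity> then \<infinity> else ennreal (sqrt (enn2real I))) \<le> ennreal r"
proof -
  assume *: "ennreal (r\<^sup>2) \<le> I" "0 \<le> r"
  show "ennreal r \<le> (if I = \<infinity> then \<infinity> else ennreal (sqrt (enn2real I)))"
    using * by (cases I) (auto intro!: ennreal_leI real_le_rsqrt)
next
  assume *: "I \<le> ennreal (r\<^sup>2)" "0 \<le> r"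
  show "(if I = \<infinity> then \<infinity> else ennreal (sqrt (enn2real I))) \<le> ennreal r"
    using * by (cases I) (auto intro!: ennreal_leI real_le_lsqrt simp: top_unique)
qed

lemma sobolev_norm_profile:
  assumes "\<delta> > 0"
  shows "ennreal 1 \<le> sobolev_norm s (synth (\<lambda>\<xi>. complex_of_real (profile \<gamma> s N \<delta> \<xi>)))"
    and "sobolev_norm s (synth (\<lambda>\<xi>. complex_of_real (profile \<gamma> s N \<delta> \<xi>))) \<le> ennreal 2"
proof -
  let ?S = "profile_support \<gamma> N \<delta>"
  let ?I = "\<integral>\<^sup>+ \<xi>. ennreal ((1 + \<xi>\<^sup>2) powr s * (norm (complex_of_real (profile \<gamma> s N \<delta> \<xi>)))\<^sup>2) \<partial>lborel"
  have S [measurable]: "?S \<in> sets lborel" unfolding profile_support_def by measurable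
  have "(1 + \<xi>\<^sup>2) powr s * (norm (complex_of_real (profile \<gamma> s N \<delta> \<xi>)))\<^sup>2 = 1 / \<delta> * indicator ?S \<xi>" for \<xi>
  proof -
    have "1 + \<xi>\<^sup>2 > 0" by (smt (verit) zero_le_power2)
    then have "(1 + \<xi>\<^sup>2) powr s * ((1 + \<xi>\<^sup>2) powr (- s / 2))\<^sup>2 = 1"
      by (simp add: power2_eq_square flip: powr_add)
    moreover have "(norm (complex_of_real (profile \<gamma> s N \<delta> \<xi>)))\<^sup>2 =
        ((1 + \<xi>\<^sup>2) powr (- s / 2))\<^sup>2 * (1 / \<delta> * indicator ?S \<xi>)"
      using assms unfolding norm_of_real power2_abs
      by (simp add: profile_def power_mult_distrib power_divide indicator_def)
    ultimately show ?thesis by (simp only: mult.assoc[symmetric] mult_1)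
  qed
  then have "?I = (\<integral>\<^sup>+ \<xi>. ennreal (1 / \<delta>) * indicator ?S \<xi> \<partial>lborel)"
    by (intro nn_integral_cong) (simp add: indicator_def)
  then have I: "?I = ennreal (1 / \<delta>) * emeasure lborel ?S"
    using nn_integral_cmult_indicator[OF S] by (rule trans)
  have "emeasure lborel {N..N + \<delta>} \<le> emeasure lborel ?S"
    by (intro emeasure_mono S) (auto simp: profile_support_def)
  then have "ennreal \<delta> \<le> emeasure lborel ?S" using assms by simp
  then have "ennreal (1 / \<delta>) * ennreal \<delta> \<le> ?I" unfolding I by (intro mult_left_mono) auto
  then have lo: "ennreal (1\<^sup>2) \<le> ?I" using assms by (simp flip: ennreal_mult)
  have "emeasure lborel ?S \<le> (emeasure lborel {N..N + \<delta>} + emeasure lborel {low_freq \<gamma> N + 2 * \<delta>..low_freq \<gamma> N + 3 * \<delta>}) +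
     (emeasure lborel {- (N + \<delta>)..- N} + emeasure lborel {- (low_freq \<gamma> N + 3 * \<delta>)..- (low_freq \<gamma> N + 2 * \<delta>)})"
    unfolding profile_support_def
    by (intro order_trans[OF emeasure_subadditive] add_mono) auto
  also have "\<dots> = ennreal (4 * \<delta>)" using assms by (simp flip: ennreal_plus)
  finally have "?I \<le> ennreal (1 / \<delta>) * ennreal (4 * \<delta>)" unfolding I by (intro mult_left_mono) auto
  then have hi: "?I \<le> ennreal (2\<^sup>2)" using assms by (simp flip: ennreal_mult)
  show "ennreal 1 \<le> sobolev_norm s (synth (\<lambda>\<xi>. complex_of_real (profile \<gamma> s N \<delta> \<xi>)))"
    unfolding sobolev_norm_synth[OF tame_profile] Let_def by (rule sobolev_value_bounds(1)[OF lo]) simp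
  show "sobolev_norm s (synth (\<lambda>\<xi>. complex_of_real (profile \<gamma> s N \<delta> \<xi>))) \<le> ennreal 2"
    unfolding sobolev_norm_synth[OF tame_profile] Let_def by (rule sobolev_value_bounds(2)[OF hi]) simp
qed

text \<open>Used to replace the weight at one frequency by the weight at a comparable frequency without
distinguishing the sign of the exponent.\<close>
lemma powr_comparable:
  fixes a b p :: real
  assumes "0 < a" "0 < b" "a / 4 \<le> b" "b \<le> 4 * a"
  shows "4 powr (- \<bar>p\<bar>) * a powr p \<le> b powr p"
proof (cases "0 \<le> p")
  case True
  have "4 powr (- \<bar>p\<bar>) * a powr p = (a / 4) powr p"
    using True assms by (simp add: powr_divide powr_minus_divide)
  also have "\<dots> \<le> b powr p" using True assms by (intro powr_mono2) auto
  finally show ?thesis .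
next
  case False
  have "4 powr (- \<bar>p\<bar>) * a powr p = (4 * a) powr p"
    using False assms by (simp add: powr_mult)
  also have "\<dots> \<le> b powr p" using False assms by (intro powr_mono2') auto
  finally show ?thesis .
qed

text \<open>For \<open>\<xi>\<close> in this interval, every \<open>\<eta>\<close> in the left half of the high interval has its partner
\<open>\<xi> - \<eta>\<close> in the low interval, so the convolution integral has at least \<open>\<delta> / 2\<close> of room, which
compensates the normalisation \<open>1 / \<delta>\<close>.\<close>
lemma profile_interaction_ge:
  assumes \<delta>: "0 < \<delta>" and N: "1 \<le> N" and p: "0 \<le> low_freq \<gamma> N" "low_freq \<gamma> N + 3 * \<delta> \<le> 1"
    and \<xi>: "\<xi> \<in> {N + low_freq \<gamma> N + 5 / 2 * \<delta>..N + low_freq \<gamma> N + 3 * \<delta>}"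
  shows "4 powr (- \<bar>s\<bar>) / 2 * (1 + \<xi>\<^sup>2) powr (- s / 2) \<le> (LBINT \<eta>. profile \<gamma> s N \<delta> \<eta> * profile \<gamma> s N \<delta> (\<xi> - \<eta>))"
proof -
  let ?g = "profile \<gamma> s N \<delta>"
  let ?k = "4 powr (- \<bar>s\<bar>) * (1 + \<xi>\<^sup>2) powr (- s / 2) / \<delta>"
  have qi: "integrable lborel (\<lambda>\<eta>. ?g \<eta> * ?g (\<xi> - \<eta>))"
  proof -
    obtain B R where B: "0 \<le> B" "\<And>x. norm (complex_of_real (?g x)) \<le> B * indicator {-R..R} x"
      using tame_bound[OF tame_profile] by metis
    have "integrable lborel (\<lambda>\<eta>. Re (complex_of_real (?g \<eta>) * complex_of_real (?g (\<xi> - \<eta>))))"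
      by (intro integrable_Re autoconv_bound(1)[OF B(2) B(1)] tame_measurable tame_profile)
    then show ?thesis by simp
  qed
  have "4 powr (- \<bar>s\<bar>) / 2 * (1 + \<xi>\<^sup>2) powr (- s / 2) = (LBINT \<eta>. ?k * indicator {N..N + \<delta> / 2} \<eta>)"
    using \<delta> by simp
  also have "\<dots> \<le> (LBINT \<eta>. ?g \<eta> * ?g (\<xi> - \<eta>))"
  proof (rule integral_mono)
    show "integrable lborel (\<lambda>\<eta>. ?k * indicator {N..N + \<delta> / 2} \<eta>)"
      by (intro integrable_mult_right integrable_real_indicator) (auto simp: emeasure_lborel_Icc_eq)
    show "integrable lborel (\<lambda>\<eta>. ?g \<eta> * ?g (\<xi> - \<eta>))" by (rule qi)
    fix \<eta>
    show "?k * indicator {N..N + \<delta> / 2} \<eta> \<le> ?g \<eta> * ?g (\<xi> - \<eta>)"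
    proof (cases "\<eta> \<in> {N..N + \<delta> / 2}")
      case True
      define \<zeta> where "\<zeta> = \<xi> - \<eta>"
      have \<zeta>: "\<zeta> \<in> {low_freq \<gamma> N + 2 * \<delta>..low_freq \<gamma> N + 3 * \<delta>}" using True \<xi> by (auto simp: \<zeta>_def)
      then have \<zeta>01: "0 \<le> \<zeta>" "\<zeta> \<le> 1" using p \<delta> by auto
      have mem: "\<eta> \<in> profile_support \<gamma> N \<delta>" "\<zeta> \<in> profile_support \<gamma> N \<delta>"
        using True \<zeta> \<delta> unfolding profile_support_def by auto
      have pos: "0 < 1 + x\<^sup>2" for x :: real by (smt (verit) zero_le_power2)
      have "0 \<le> \<eta>" "\<eta> \<le> \<xi>" "\<xi> \<le> 2 * \<eta>" using \<zeta>01 True N by (auto simp: \<zeta>_def)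
      then have "\<eta>\<^sup>2 \<le> \<xi>\<^sup>2" "\<xi>\<^sup>2 \<le> (2 * \<eta>)\<^sup>2"
        by (intro power_mono; linarith)+
      then have 1: "4 powr (- \<bar>- s / 2\<bar>) * (1 + \<xi>\<^sup>2) powr (- s / 2) \<le> (1 + \<eta>\<^sup>2) powr (- s / 2)"
        by (intro powr_comparable pos) (auto simp: power_mult_distrib)
      have "\<zeta>\<^sup>2 \<le> 1" using \<zeta>01 by (simp add: power_le_one)
      then have 2: "4 powr (- \<bar>- s / 2\<bar>) * 1 powr (- s / 2) \<le> (1 + \<zeta>\<^sup>2) powr (- s / 2)"
        by (intro powr_comparable pos) (auto simp: add_pos_nonneg)
      have "4 powr (- \<bar>- s / 2\<bar>) * (4 powr (- \<bar>- s / 2\<bar>)) = 4 powr (- \<bar>s\<bar>)"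
        by (simp flip: powr_add)
      then have "4 powr (- \<bar>s\<bar>) * (1 + \<xi>\<^sup>2) powr (- s / 2) =
          (4 powr (- \<bar>- s / 2\<bar>) * (1 + \<xi>\<^sup>2) powr (- s / 2)) * (4 powr (- \<bar>- s / 2\<bar>) * 1 powr (- s / 2))"
        by (simp add: mult_ac)
      also have "\<dots> \<le> (1 + \<eta>\<^sup>2) powr (- s / 2) * (1 + \<zeta>\<^sup>2) powr (- s / 2)"
        by (intro mult_mono 1 2) auto
      finally have "?k \<le> (1 + \<eta>\<^sup>2) powr (- s / 2) * (1 + \<zeta>\<^sup>2) powr (- s / 2) / \<delta>"
        using \<delta> by (intro divide_right_mono) auto
      also have "\<dots> = ?g \<eta> * ?g \<zeta>" using mem \<delta> by (simp add: profile_def)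
      finally show ?thesis using True by (simp add: \<zeta>_def)
    next
      case False
      then show ?thesis using profile_nonneg \<delta> by (simp add: less_imp_le)
    qed
  qed
  finally show ?thesis .
qed

text \<open>Among the sixteen ways to pick two of the four intervals, only high plus low, in either order,
reaches the output frequencies considered.\<close>
lemma profile_interaction_support:
  assumes \<delta>: "0 < \<delta>" and p: "0 \<le> low_freq \<gamma> N" "low_freq \<gamma> N + 4 * \<delta> < N"
    and \<xi>: "\<xi> \<in> {N + low_freq \<gamma> N + 5 / 2 * \<delta>..N + low_freq \<gamma> N + 3 * \<delta>}"
    and nz: "profile \<gamma> s N \<delta> \<eta> * profile \<gamma> s N \<delta> (\<xi> - \<eta>) \<noteq> 0"
  shows "(\<eta> \<in> {N..N + \<delta>} \<and> \<xi> - \<eta> \<in> {low_freq \<gamma> N + 2 * \<delta>..low_freq \<gamma> N + 3 * \<delta>}) \<or>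
         (\<xi> - \<eta> \<in> {N..N + \<delta>} \<and> \<eta> \<in> {low_freq \<gamma> N + 2 * \<delta>..low_freq \<gamma> N + 3 * \<delta>})"
proof -
  have "\<eta> \<in> profile_support \<gamma> N \<delta>" "\<xi> - \<eta> \<in> profile_support \<gamma> N \<delta>"
    using nz by (auto simp: profile_def indicator_def split: if_splits)
  then show ?thesis
    using \<delta> p \<xi> unfolding profile_support_def Un_iff atLeastAtMost_iff by (elim disjE conjE; (linarith | blast))
qed

text \<open>Counting powers of \<open>N\<close>: the derivative in the nonlinearity contributes \<open>N\<close>, the interval of output
frequencies has length of order \<open>1 / N\<^sup>2\<close> and contributes \<open>1 / N\<close> to the norm, and \<open>s\<close> cancels
because the low frequency carries no weight. Exactly the factor \<open>N powr a\<close> of the additional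
derivatives remains.\<close>
lemma sobolev_norm_picard_profile_ge:
  assumes \<gamma>: "\<gamma> \<le> 0" and t: "t > 0" and c: "0 < c" "c \<le> 1" "36 * c * t \<le> 1"
    and L: "L = sqrt (- \<gamma> / 3) + 4" and a: "a > 0"
    and N: "L + 1 \<le> N" "2 * t * (3 * (2 * L + L\<^sup>2) * L - \<gamma> * L) \<le> N" and \<delta>: "\<delta> = c / N\<^sup>2"
  shows "ennreal (N powr a * (t * 4 powr (- \<bar>s\<bar>) / 4 * sqrt (c / 2))) \<le>
     sobolev_norm (s + a) (picard_nonlinear \<gamma> t (synth (\<lambda>\<xi>. complex_of_real (profile \<gamma> s N \<delta> \<xi>))))"
proof -
  let ?g = "profile \<gamma> s N \<delta>"
  let ?D = "duhamel \<gamma> t (\<lambda>\<xi>. complex_of_real (?g \<xi>))"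
  let ?J = "{N + low_freq \<gamma> N + 5 / 2 * \<delta>..N + low_freq \<gamma> N + 3 * \<delta>}"
  let ?K = "3 * (2 * L + L\<^sup>2) * L - \<gamma> * L"
  let ?k = "t * 4 powr (- \<bar>s\<bar>) / 4"
  have L4: "4 \<le> L" using L \<gamma> by simp
  have N1: "1 \<le> N" "0 < N" using N(1) L4 by auto
  have \<delta>0: "0 < \<delta>" using c N1 by (simp add: \<delta>)
  have p0: "0 \<le> low_freq \<gamma> N" using \<gamma> N1 by (simp add: low_freq_def)
  have pL: "low_freq \<gamma> N + 4 * \<delta> \<le> L / N"
  proof -
    have "c / N\<^sup>2 \<le> 1 / N" using c N1 by (intro frac_le) (auto simp: power2_eq_square)
    then show ?thesis by (simp add: low_freq_def \<delta> L add_divide_distrib)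
  qed
  have "L / N \<le> 1" using N(1) N1 by simp
  then have p1: "low_freq \<gamma> N + 3 * \<delta> \<le> 1" and pN: "low_freq \<gamma> N + 4 * \<delta> < N"
    using pL \<delta>0 N(1) L4 by linarith+
  have small: "18 * c * t + ?K / N * t \<le> 1"
  proof -
    have "?K / N * t \<le> 1 / 2" using N(2) N1 by (simp add: field_simps)
    then show ?thesis using c(3) by linarith
  qed
  have res1: "\<bar>phi \<gamma> (\<eta> + \<zeta>) - phi \<gamma> \<eta> - phi \<gamma> \<zeta>\<bar> * t \<le> 1"
    if "\<eta> \<in> {N..N + \<delta>}" "\<zeta> \<in> {low_freq \<gamma> N + 2 * \<delta>..low_freq \<gamma> N + 3 * \<delta>}" for \<eta> \<zeta>
  proof -
    have "\<bar>phi \<gamma> (\<eta> + \<zeta>) - phi \<gamma> \<eta> - phi \<gamma> \<zeta>\<bar> * t \<le> (18 * c + ?K / N) * t"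
      using resonance_bound[OF \<gamma> N1(1) \<delta> c(1,2) L that] t by (intro mult_right_mono) auto
    then show ?thesis using small by (simp add: distrib_right)
  qed
  have D_ge: "N * (?k * (1 + \<xi>\<^sup>2) powr (- s / 2)) \<le> norm (?D \<xi>)" if \<xi>: "\<xi> \<in> ?J" for \<xi>
  proof -
    have res: "\<bar>phi \<gamma> \<xi> - phi \<gamma> \<eta> - phi \<gamma> (\<xi> - \<eta>)\<bar> * t \<le> 1" if nz: "?g \<eta> * ?g (\<xi> - \<eta>) \<noteq> 0" for \<eta>
      using profile_interaction_support[OF \<delta>0 p0 pN \<xi> nz]
    proof (elim disjE conjE)
      assume "\<eta> \<in> {N..N + \<delta>}" "\<xi> - \<eta> \<in> {low_freq \<gamma> N + 2 * \<delta>..low_freq \<gamma> N + 3 * \<delta>}"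
      from res1[OF this] show ?thesis by simp
    next
      assume "\<xi> - \<eta> \<in> {N..N + \<delta>}" "\<eta> \<in> {low_freq \<gamma> N + 2 * \<delta>..low_freq \<gamma> N + 3 * \<delta>}"
      note res1[OF this]
      moreover have "phi \<gamma> \<xi> - phi \<gamma> \<eta> - phi \<gamma> (\<xi> - \<eta>) = phi \<gamma> (\<xi> - \<eta> + \<eta>) - phi \<gamma> (\<xi> - \<eta>) - phi \<gamma> \<eta>" by simp
      ultimately show ?thesis by (simp only:)
    qed
    have "?k * (1 + \<xi>\<^sup>2) powr (- s / 2) = t / 2 * (4 powr (- \<bar>s\<bar>) / 2 * (1 + \<xi>\<^sup>2) powr (- s / 2))" by simp
    also have "\<dots> \<le> t / 2 * (LBINT \<eta>. ?g \<eta> * ?g (\<xi> - \<eta>))"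
      using t by (intro mult_left_mono profile_interaction_ge[OF \<delta>0 N1(1) p0 p1 \<xi>]) auto
    finally have q: "?k * (1 + \<xi>\<^sup>2) powr (- s / 2) \<le> t / 2 * (LBINT \<eta>. ?g \<eta> * ?g (\<xi> - \<eta>))" .
    have "N * (?k * (1 + \<xi>\<^sup>2) powr (- s / 2)) \<le> \<bar>\<xi>\<bar> * (t / 2 * (LBINT \<eta>. ?g \<eta> * ?g (\<xi> - \<eta>)))"
      by (rule mult_mono[OF _ q]) (use \<xi> p0 \<delta>0 N1 t in auto)
    also have "\<dots> \<le> norm (?D \<xi>)"
      using \<delta>0 t by (intro norm_duhamel_ge tame_profile profile_nonneg res) auto
    finally show ?thesis .
  qed
  have point: "N powr (2 * a) * (N * ?k)\<^sup>2 \<le> (1 + \<xi>\<^sup>2) powr (s + a) * (norm (?D \<xi>))\<^sup>2" if \<xi>: "\<xi> \<in> ?J" for \<xi>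
  proof -
    have pos: "0 < 1 + \<xi>\<^sup>2" by (smt (verit) zero_le_power2)
    have "N\<^sup>2 \<le> \<xi>\<^sup>2" using \<xi> p0 \<delta>0 N1 by (intro power_mono) auto
    then have "(N\<^sup>2) powr a \<le> (1 + \<xi>\<^sup>2) powr a" using a by (intro powr_mono2) auto
    moreover have "(N\<^sup>2) powr a = N powr (2 * a)"
      using N1 by (simp add: powr_powr flip: powr_numeral)
    ultimately have "N powr (2 * a) * (N * ?k)\<^sup>2 \<le> (1 + \<xi>\<^sup>2) powr a * (N * ?k)\<^sup>2"
      by (intro mult_right_mono) auto
    also have "\<dots> = (1 + \<xi>\<^sup>2) powr (s + a) * (N * (?k * (1 + \<xi>\<^sup>2) powr (- s / 2)))\<^sup>2"
    proof -
      have "(1 + \<xi>\<^sup>2) powr (s + a) * ((1 + \<xi>\<^sup>2) powr (- s / 2))\<^sup>2 = (1 + \<xi>\<^sup>2) powr a"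
        using pos by (simp add: power2_eq_square flip: powr_add)
      then have "(1 + \<xi>\<^sup>2) powr a * (N * ?k)\<^sup>2 =
        ((1 + \<xi>\<^sup>2) powr (s + a) * ((1 + \<xi>\<^sup>2) powr (- s / 2))\<^sup>2) * (N * ?k)\<^sup>2" by simp
      then show ?thesis by (simp only: power_mult_distrib mult_ac)
    qed
    also have "\<dots> \<le> (1 + \<xi>\<^sup>2) powr (s + a) * (norm (?D \<xi>))\<^sup>2"
      using N1 t by (intro mult_left_mono power_mono D_ge \<xi>) auto
    finally show ?thesis .
  qed
  let ?I = "\<integral>\<^sup>+ \<xi>. ennreal ((1 + \<xi>\<^sup>2) powr (s + a) * (norm (?D \<xi>))\<^sup>2) \<partial>lborel"
  let ?r = "N powr a * (?k * sqrt (c / 2))"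
  have r: "?r\<^sup>2 = N powr (2 * a) * (N * ?k)\<^sup>2 * (\<delta> / 2)"
  proof -
    have "N powr (2 * a) = (N powr a)\<^sup>2" by (simp add: power2_eq_square flip: powr_add)
    then show ?thesis using c N1 by (simp add: \<delta> power_mult_distrib field_simps)
  qed
  have "ennreal (?r\<^sup>2) = ennreal (N powr (2 * a) * (N * ?k)\<^sup>2) * emeasure lborel ?J"
    unfolding r using \<delta>0 by (simp add: algebra_simps flip: ennreal_mult)
  also have "\<dots> = (\<integral>\<^sup>+ \<xi>. ennreal (N powr (2 * a) * (N * ?k)\<^sup>2) * indicator ?J \<xi> \<partial>lborel)"
    by (rule nn_integral_cmult_indicator[symmetric]) simp
  also have "\<dots> \<le> ?I"
  proof (intro nn_integral_mono)
    fix \<xi>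
    show "ennreal (N powr (2 * a) * (N * ?k)\<^sup>2) * indicator ?J \<xi>
        \<le> ennreal ((1 + \<xi>\<^sup>2) powr (s + a) * (norm (?D \<xi>))\<^sup>2)"
    proof (cases "\<xi> \<in> ?J")
      case True
      then show ?thesis using ennreal_leI[OF point[OF True]] by (simp only: indicator_simps mult_1_right)
    next
      case False
      then show ?thesis by (simp only: indicator_simps mult_zero_right zero_le simp_thms)
    qed
  qed
  finally have "ennreal (?r\<^sup>2) \<le> ?I" .
  then show ?thesis
    unfolding sobolev_norm_picard[OF tame_profile] Let_def
    by (rule sobolev_value_bounds(1)) (use t c in auto)
qed

theorem mainTheorem5:
  fixes \<gamma> s t :: real
  assumes "\<gamma> \<le> 0" and "t > 0"
  shows "\<exists>(f :: nat \<Rightarrow> real \<Rightarrow> real) (N0 :: nat).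
    (\<exists>c C :: real. 0 < c \<and> 0 < C \<and>
       (\<forall>N\<ge>N0. ennreal c \<le> sobolev_norm s (\<lambda>x. complex_of_real (f N x)) \<and>
               sobolev_norm s (\<lambda>x. complex_of_real (f N x)) \<le> ennreal C)) \<and>
    (\<forall>a :: real. a > 0 \<longrightarrow>
       (SUP N\<in>{N0..}. sobolev_norm (s + a)
          (picard_nonlinear \<gamma> t (\<lambda>x. complex_of_real (f N x)))) = \<infinity>)"
proof -
  define L where "L = sqrt (- \<gamma> / 3) + 4"
  \<comment> \<open>makes the leading part \<open>18 * c\<close> of the resonance bound at most \<open>1 / (2 * t)\<close>; the error term of
    order \<open>1 / N\<close> has the same bound from \<open>N0\<close> on\<close>
  define c where "c = min 1 (1 / (36 * t))"
  define \<delta> where "\<delta> N = c / (real N)\<^sup>2" for N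
  define G where "G N = (\<lambda>\<xi>. complex_of_real (profile \<gamma> s (real N) (\<delta> N) \<xi>))" for N
  define f where "f N x = Re (synth (G N) x)" for N x
  define N0 where "N0 = nat \<lceil>max (L + 1) (2 * t * (3 * (2 * L + L\<^sup>2) * L - \<gamma> * L))\<rceil>"
  have c: "0 < c" "c \<le> 1" "36 * c * t \<le> 1"
    using assms(2) by (auto simp: c_def min_def field_simps)
  have f: "(\<lambda>x. complex_of_real (f N x)) = synth (G N)" for N
    unfolding f_def G_def by (intro ext synth_real_of_even profile_even)
  have N0: "L + 1 \<le> real N" "2 * t * (3 * (2 * L + L\<^sup>2) * L - \<gamma> * L) \<le> real N" if "N0 \<le> N" for N
  proof -
    have "max (L + 1) (2 * t * (3 * (2 * L + L\<^sup>2) * L - \<gamma> * L)) \<le> real N0"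
      unfolding N0_def by linarith
    then show "L + 1 \<le> real N" "2 * t * (3 * (2 * L + L\<^sup>2) * L - \<gamma> * L) \<le> real N"
      using that by auto
  qed
  have norm: "ennreal 1 \<le> sobolev_norm s (synth (G N)) \<and> sobolev_norm s (synth (G N)) \<le> ennreal 2" if "N0 \<le> N" for N
  proof -
    have "0 < real N" using N0(1)[OF that] assms(1) unfolding L_def
      by (smt (verit) real_sqrt_ge_zero divide_nonneg_nonneg)
    then have "0 < \<delta> N" using c by (simp add: \<delta>_def)
    then show ?thesis using sobolev_norm_profile unfolding G_def by blast
  qed
  have sup: "(SUP N\<in>{N0..}. sobolev_norm (s + a) (picard_nonlinear \<gamma> t (synth (G N)))) = \<infinity>" if a: "a > 0" for a
  proof -
    define k where "k = t * 4 powr (- \<bar>s\<bar>) / 4 * sqrt (c / 2)"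
    have k: "0 < k" using assms(2) c by (simp add: k_def)
    have "\<exists>N\<in>{N0..}. y < sobolev_norm (s + a) (picard_nonlinear \<gamma> t (synth (G N)))" if y: "y < top" for y
    proof -
      obtain r where r: "0 \<le> r" "y = ennreal r" using y by (cases y) auto
      define M where "M = ((r + 1) / k) powr (1 / a)"
      define N where "N = max N0 (nat \<lceil>M\<rceil>)"
      have "M \<le> real N" unfolding N_def by linarith
      have "(r + 1) / k = M powr a" using a r k by (simp add: M_def powr_powr)
      also have "\<dots> \<le> real N powr a" using a \<open>M \<le> real N\<close> by (intro powr_mono2) (auto simp: M_def)
      finally have "r + 1 \<le> real N powr a * k" using k by (simp add: divide_le_eq)
      then have "y < ennreal (real N powr a * k)" unfolding r(2) using r(1) by (intro ennreal_lessI) auto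
      also have "\<dots> \<le> sobolev_norm (s + a) (picard_nonlinear \<gamma> t (synth (G N)))"
        unfolding k_def G_def
        by (rule sobolev_norm_picard_profile_ge[OF assms c L_def a N0 \<delta>_def]) (auto simp: N_def)
      finally show ?thesis by (intro bexI[of _ N]) (auto simp: N_def)
    qed
    then show ?thesis by (simp add: SUP_eq_top_iff)
  qed
  show ?thesis
    by (intro exI[of _ f] exI[of _ N0] exI[of _ "1::real"] exI[of _ "2::real"] conjI allI impI)
       (use norm sup in \<open>auto simp: f\<close>)
qed

end
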